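(* Let $n>1$ be a positive odd integer and let $m$ be either $n-1$ or $(n+1)/2$. Then \[ \sum_{k=0}^{m}(-1)^k [4k-1]\frac{(q^{-1};q^2)_k^5}{(q^2;q^2)_k^5}\, q^{k^2+5k} \equiv [n](-q)^{(n+1)(n-3)/4}\sum_{k=0}^{(n+1)/2} \frac{(q^{-1};q^2)_k^2\, (q^3;q^2)_k}{(q^2;q^2)_k^3 }\, q^{3k} \pmod{[n]\Phi_n(q)^2}. \]
   Context: Here $q$ is an indeterminate. For $x$ and a base $p$ (a power of $q$), $(x;p)_k=\prod_{j=0}^{k-1}(1-xp^j)$ for integers $k\ge0$. The $q$-integer is $[j]=1+q+\cdots+q^{j-1}$ for $j\ge1$, with $[j]=(1-q^j)/(1-q)$ in general (so $[-1]=-q^{-1}$), and $\Phi_n(q)$ is the $n$-th cyclotomic polynomial. For rational functions $A(q),B(q)$ and a polynomial $P(q)$, $A\equiv B\pmod{P}$ means that the numerator of the reduced form of $A-B$ is divisible by $P$ in $\mathbb{Z}[q]$. *)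

theory Defs
  imports Complex_Main "HOL-Computational_Algebra.Computational_Algebra"
begin

text \<open>
  The indeterminate \<open>q\<close>, as an element of the field of rational functions
  (the fraction field of \<open>\<int>[q]\<close>).
\<close>

definition q :: "int poly fract" where
  "q = to_fract [:0, 1:]"

definition qpoch :: "'a :: comm_ring_1 \<Rightarrow> 'a \<Rightarrow> nat \<Rightarrow> 'a" where
  "qpoch x p k = (\<Prod>j<k. 1 - x * p ^ j)"

definition qint :: "int \<Rightarrow> int poly fract" where
  "qint j = (1 - q powi j) / (1 - q)"

text \<open>For \<open>j \<ge> 1\<close>, the \<open>q\<close>-integer as an element of \<open>\<int>[q]\<close>; it is needed for the modulus.\<close>

definition qint_poly :: "nat \<Rightarrow> int poly" where
  "qint_poly n = (\<Sum>j<n. monom 1 j)"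

text \<open>
  \<open>quot_of_fract\<close> yields numerator and denominator of the reduced form, coprime in \<open>\<int>[q]\<close>.
\<close>

definition fract_cong :: "int poly fract \<Rightarrow> int poly fract \<Rightarrow> int poly \<Rightarrow> bool" where
  "fract_cong A B P \<longleftrightarrow> P dvd fst (quot_of_fract (A - B))"

definition primitive_roots_unity :: "nat \<Rightarrow> complex set" where
  "primitive_roots_unity n = {z. z ^ n = 1 \<and> (\<forall>d. 0 < d \<and> d < n \<longrightarrow> z ^ d \<noteq> 1)}"

text \<open>
  The cyclotomic polynomial is a product of linear factors over \<open>\<complex>\<close>, whose coefficients are
  integers; \<open>of_int_cyclotomic\<close> below shows that the definite description is
  well-defined for \<open>n > 0\<close>.
\<close>

definition cyclotomic :: "nat \<Rightarrow> int poly" where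
  "cyclotomic n = (THE p. map_poly of_int p = (\<Prod>z\<in>primitive_roots_unity n. [:- z, 1:]))"

lemma q_nonzero: "q \<noteq> 0" and q_neq_1: "q \<noteq> 1"
proof -
  have "[:0, 1:] \<noteq> (1 :: int poly)" by (simp add: one_pCons)
  then have "q \<noteq> to_fract 1" unfolding q_def by (simp only: to_fract_eq_iff not_False_eq_True)
  then show "q \<noteq> 1" by simp
qed (simp add: q_def)

lemma qint_minus_1: "qint (- 1) = - inverse q"
  using q_nonzero q_neq_1 by (simp add: qint_def field_simps)

lemma to_fract_power: "to_fract (p ^ k) = to_fract p ^ k"
  by (induction k) simp_all

lemma to_fract_sum: "to_fract (\<Sum>i\<in>A. f i) = (\<Sum>i\<in>A. to_fract (f i))"
  by (induction A rule: infinite_finite_induct) simp_all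

lemma to_fract_qint_poly: "to_fract (qint_poly n) = qint (int n)"
proof -
  have "to_fract (monom 1 j) = q ^ j" for j
    by (simp add: q_def monom_altdef to_fract_power)
  then have "to_fract (qint_poly n) = (\<Sum>j<n. q ^ j)"
    by (simp add: qint_poly_def to_fract_sum)
  also have "\<dots> = (1 - q ^ n) / (1 - q)"
    using q_neq_1 by (simp add: sum_gp_strict)
  finally show ?thesis by (simp add: qint_def)
qed

lemma map_poly_of_int_mult:
  "map_poly of_int (p * r) = map_poly of_int p * (map_poly of_int r :: complex poly)"
  by (simp add: poly_eq_iff coeff_map_poly coeff_mult)

lemma map_poly_of_int_add:
  "map_poly of_int (p + r) = map_poly of_int p + (map_poly of_int r :: complex poly)"
  by (simp add: poly_eq_iff coeff_map_poly)

lemma map_poly_of_int_eq_iff: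
  "map_poly of_int p = (map_poly of_int r :: complex poly) \<longleftrightarrow> p = r"
  by (simp add: poly_eq_iff coeff_map_poly)

lemma degree_map_poly_of_int: "degree (map_poly of_int p :: complex poly) = degree p"
  by (cases "p = 0") (auto intro!: degree_map_poly)

lemma int_quotient_of_monic:
  fixes p :: "complex poly" and f g :: "int poly"
  assumes eq: "map_poly of_int f = map_poly of_int g * p" and monic: "lead_coeff g = 1"
  shows "\<exists>h. p = map_poly of_int h"
proof -
  obtain h r where hr: "pseudo_divmod f g = (h, r)" by fastforce
  have g: "g \<noteq> 0" using monic by auto
  have f: "f = g * h + r" and r: "r = 0 \<or> degree r < degree g"
    using pseudo_divmod[OF g hr] monic by simp_all
  have eq': "map_poly of_int g * (p - map_poly of_int h) = (map_poly of_int r :: complex poly)"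
    using eq unfolding f by (simp add: map_poly_of_int_mult map_poly_of_int_add algebra_simps)
  have "p - map_poly of_int h = 0"
  proof (rule ccontr)
    assume *: "p - map_poly of_int h \<noteq> 0"
    have g': "(map_poly of_int g :: complex poly) \<noteq> 0"
      using g map_poly_of_int_eq_iff[of g 0] by simp
    have "r \<noteq> 0" using eq' * g' by auto
    moreover have "degree r = degree g + degree (p - map_poly of_int h)"
      using degree_mult_eq[OF g' *] unfolding eq' degree_map_poly_of_int .
    ultimately show False using r by auto
  qed
  then show ?thesis by auto
qed

lemma roots_unity_partition:
  assumes "n > 0"
  shows "{z. z ^ n = 1} = (\<Union>d\<in>{d. d dvd n}. primitive_roots_unity d)"
proof (intro equalityI subsetI)
  fix z :: complex assume "z \<in> {z. z ^ n = 1}"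
  then have z: "z ^ n = 1" by simp
  define d where "d = (LEAST d. 0 < d \<and> z ^ d = 1)"
  have d: "0 < d \<and> z ^ d = 1"
    unfolding d_def by (rule LeastI[of _ n]) (use z assms in simp)
  have least: "z ^ e \<noteq> 1" if "0 < e" "e < d" for e
    using not_less_Least[of e "\<lambda>d. 0 < d \<and> z ^ d = 1"] that unfolding d_def by auto
  have "z ^ n = z ^ (d * (n div d) + n mod d)" by simp
  also have "\<dots> = (z ^ d) ^ (n div d) * z ^ (n mod d)" by (simp only: power_add power_mult)
  finally have "z ^ (n mod d) = 1" using d z by simp
  then have "n mod d = 0" using least[of "n mod d"] d by (cases "n mod d = 0") auto
  then show "z \<in> (\<Union>d\<in>{d. d dvd n}. primitive_roots_unity d)"
    using d least by (auto simp: primitive_roots_unity_def)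
next
  fix z assume "z \<in> (\<Union>d\<in>{d. d dvd n}. primitive_roots_unity d)"
  then show "z \<in> {z. z ^ n = 1}"
    by (auto simp: primitive_roots_unity_def power_mult)
qed

lemma prod_linear_monic:
  fixes A :: "complex set"
  shows "lead_coeff (\<Prod>z\<in>A. [:- z, 1:]) = 1"
  by (simp add: lead_coeff_prod)

lemma prod_roots_unity:
  assumes "n > 0"
  shows "(\<Prod>z | z ^ n = 1. [:- z, 1:]) = (monom 1 n - 1 :: complex poly)"
proof (rule poly_eqI_degree_lead_coeff[where A = "{z. z ^ n = 1}" and n = n])
  have fin: "finite {z :: complex. z ^ n = 1}"
    using finite_roots_unity[of n] assms by auto
  have card: "card {z :: complex. z ^ n = 1} = n"
    using assms by (rule card_roots_unity_eq)
  have deg: "degree (\<Prod>z | z ^ n = 1. [:- z, 1:] :: complex poly) = n"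
    by (subst degree_prod_sum_eq) (simp_all add: card)
  then show "degree (\<Prod>z | z ^ n = 1. [:- z, 1:] :: complex poly) \<le> n" by simp
  show "n \<le> card {z :: complex. z ^ n = 1}" using card by simp
  show "degree (monom 1 n - 1 :: complex poly) \<le> n"
    by (intro degree_diff_le) (simp_all add: degree_monom_le)
  show "coeff (\<Prod>z | z ^ n = 1. [:- z, 1:]) n = coeff (monom 1 n - 1 :: complex poly) n"
    using prod_linear_monic[of "{z. z ^ n = 1}"] assms unfolding deg by simp
  fix z :: complex assume "z \<in> {z. z ^ n = 1}"
  then show "poly (\<Prod>z | z ^ n = 1. [:- z, 1:]) z = poly (monom 1 n - 1) z"
    using fin by (auto simp: poly_prod poly_monom)
qed

lemma prod_primitive_roots_int:
  assumes "n > 0"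
  shows "\<exists>p :: int poly. map_poly of_int p = (\<Prod>z\<in>primitive_roots_unity n. [:- z, 1:])"
  using assms
proof (induction n rule: less_induct)
  case (less n)
  define P where "P d = (\<Prod>z\<in>primitive_roots_unity d. [:- z, 1:])" for d
  define D where "D = {d. d dvd n \<and> d \<noteq> n}"
  have D: "finite D" "n \<notin> D" "{d. d dvd n} = insert n D"
    using less.prems by (auto simp: D_def)
  have fin: "finite (primitive_roots_unity d)" if "d dvd n" for d
  proof (rule finite_subset)
    show "finite {z :: complex. z ^ n = 1}"
      using finite_roots_unity[of n] less.prems by auto
    show "primitive_roots_unity d \<subseteq> {z. z ^ n = 1}"
      using roots_unity_partition[OF less.prems] that by blast
  qed
  have disj: "primitive_roots_unity d \<inter> primitive_roots_unity e = {}"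
    if "d dvd n" "e dvd n" "d \<noteq> e" for d e
    using that less.prems
    by (cases d e rule: linorder_cases) (auto simp: primitive_roots_unity_def dvd_pos_nat)
  have "(monom 1 n - 1 :: complex poly) = (\<Prod>d | d dvd n. P d)"
    unfolding prod_roots_unity[OF less.prems, symmetric] roots_unity_partition[OF less.prems] P_def
    by (rule prod.UNION_disjoint) (use less.prems fin disj in auto)
  also have "\<dots> = (\<Prod>d\<in>D. P d) * P n"
    using D by (simp add: mult.commute)
  finally have eq: "(monom 1 n - 1 :: complex poly) = (\<Prod>d\<in>D. P d) * P n" .
  have "\<exists>p. map_poly of_int p = P d" if "d \<in> D" for d
  proof -
    have "d \<le> n" "d > 0" "d \<noteq> n"
      using that less.prems by (auto simp: D_def dvd_imp_le dvd_pos_nat)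
    then show ?thesis unfolding P_def by (intro less.IH) simp_all
  qed
  then obtain h where h: "\<And>d. d \<in> D \<Longrightarrow> map_poly of_int (h d) = P d" by metis
  have g: "map_poly of_int (\<Prod>d\<in>E. h d) = (\<Prod>d\<in>E. P d)" if "E \<subseteq> D" for E
    using finite_subset[OF that D(1)] that
    by (induction E rule: finite_induct) (simp_all add: map_poly_of_int_mult h)
  have "lead_coeff (map_poly of_int (\<Prod>d\<in>D. h d) :: complex poly) = 1"
    by (simp add: g lead_coeff_prod P_def)
  then have "lead_coeff (\<Prod>d\<in>D. h d) = 1"
    unfolding degree_map_poly_of_int by (simp add: coeff_map_poly)
  moreover have "map_poly of_int (monom 1 n - 1 :: int poly) = (monom 1 n - 1 :: complex poly)"
    by (simp add: poly_eq_iff coeff_map_poly)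
  then have "map_poly of_int (monom 1 n - 1 :: int poly) = map_poly of_int (\<Prod>d\<in>D. h d) * P n"
    using eq g[of D] by simp
  ultimately show ?case
    using int_quotient_of_monic unfolding P_def by metis
qed

lemma of_int_cyclotomic:
  assumes "n > 0"
  shows "map_poly of_int (cyclotomic n) = (\<Prod>z\<in>primitive_roots_unity n. [:- z, 1:])"
proof -
  have "\<exists>!p :: int poly. map_poly of_int p = (\<Prod>z\<in>primitive_roots_unity n. [:- z, 1:])"
    using prod_primitive_roots_int[OF assms] map_poly_of_int_eq_iff by metis
  then show ?thesis unfolding cyclotomic_def by (rule theI')
qed

end

theory Submission
  imports Defs "HOL-Analysis.Analysis"
begin

text \<open>
  Replace two of the five factors \<open>(q\<^sup>-\<^sup>1; q\<^sup>2)\<^sub>k\<close> by \<open>(x q\<^sup>-\<^sup>1; q\<^sup>2)\<^sub>k\<close> and \<open>(q\<^sup>-\<^sup>1/x; q\<^sup>2)\<^sub>k\<close>, with the matching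
  change in the denominators. Both sides then depend on \<open>x\<close> only through \<open>y = x + 1/x\<close>, and they
  agree at \<open>x = q\<^sup>n\<close> by a limiting case of Watson's transformation of a terminating very-well-poised
  series. The original series is the case \<open>y = 2\<close>, and \<open>q\<^sup>n + q\<^sup>-\<^sup>n\<close> differs from \<open>2\<close> by a multiple of
  \<open>\<Phi>\<^sub>n(q)\<^sup>2\<close>. The third factor \<open>\<Phi>\<^sub>n(q)\<close> appears because at a primitive \<open>n\<close>-th root of unity both sides
  vanish for every \<open>y\<close>: the terms \<open>k\<close> and \<open>(n+1)/2 - k\<close> of the left-hand sum cancel. At a root of
  unity of smaller order \<open>d > 1\<close>, where \<open>d\<close> divides \<open>n\<close>, the left-hand sum tends to a combination of
  blocks of length \<open>d\<close>, each of which vanishes by the same cancellation.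

  Divisibility of the numerator is tested analytically: the rational functions are evaluated at
  complex numbers tending to a root of unity, and the order of vanishing is read off there.
\<close>

section \<open>Terminating basic hypergeometric series\<close>

lemma qpoch_0 [simp]: "qpoch x p 0 = 1"
  by (simp add: qpoch_def)

lemma qpoch_Suc: "qpoch x p (Suc k) = qpoch x p k * (1 - x * p ^ k)"
  by (simp add: qpoch_def)

lemma qpoch_add: "qpoch x p (m + k) = qpoch x p m * qpoch (x * p ^ m) p k"
  by (induction k) (simp_all add: qpoch_Suc power_add mult_ac)

lemma qpoch_Suc_left: "qpoch x p (Suc k) = (1 - x) * qpoch (x * p) p k"
  using qpoch_add[of x p 1 k] by (simp add: qpoch_Suc)

lemma qpoch_neq_0_mono:
  fixes x :: "'a :: idom"
  assumes "qpoch x p m \<noteq> 0" and "k \<le> m"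
  shows "qpoch x p k \<noteq> 0"
  using assms qpoch_add[of x p k "m - k"] by auto

section \<open>The terminating q-Chu-Vandermonde sum\<close>

text \<open>Up to the factor \<open>(- 1) ^ i * p ^ (i choose 2)\<close> this is the Gaussian
  binomial coefficient of \<open>M\<close> and \<open>i\<close>. The product of differences avoids
  negative powers of \<open>p\<close> and vanishes by itself for \<open>M < i\<close>.\<close>

definition vandermonde_coeff :: "'a :: field \<Rightarrow> nat \<Rightarrow> nat \<Rightarrow> 'a" where
  "vandermonde_coeff p M i = (\<Prod>l<i. p ^ M - p ^ l) / qpoch p p i"

lemma vandermonde_coeff_0 [simp]: "vandermonde_coeff p M 0 = 1"
  by (simp add: vandermonde_coeff_def)

lemma vandermonde_coeff_eq_0: "M < i \<Longrightarrow> vandermonde_coeff p M i = 0"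
  by (force simp: vandermonde_coeff_def)

text \<open>A q-Pascal rule: the factor \<open>l = 0\<close> of the left-hand numerator is
  \<open>p ^ Suc M - 1\<close>, and each other factor is \<open>p\<close> times a factor of the
  numerator for \<open>M\<close>.\<close>

lemma vandermonde_coeff_pascal:
  assumes "qpoch p p (Suc i) \<noteq> 0"
  shows "vandermonde_coeff p (Suc M) (Suc i)
    = vandermonde_coeff p M (Suc i) - p ^ M * vandermonde_coeff p M i"
proof -
  have 1: "(\<Prod>l<Suc i. p ^ Suc M - p ^ l) = (p ^ Suc M - 1) * p ^ i * (\<Prod>l<i. p ^ M - p ^ l)"
    by (simp add: prod.lessThan_Suc_shift prod.distrib flip: right_diff_distrib del: prod.lessThan_Suc)
  have nz: "qpoch p p i \<noteq> 0" "1 - p * p ^ i \<noteq> 0"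
    using assms by (auto simp: qpoch_Suc)
  show ?thesis unfolding vandermonde_coeff_def 1
    using nz by (simp add: qpoch_Suc divide_simps) (simp add: algebra_simps)
qed

text \<open>Induction on \<open>M\<close> through the q-Pascal rule. The second part of each term
  belongs to the sum for \<open>B * p\<close> and \<open>C * p\<close>, whose quotient is again
  \<open>C / B\<close>; hence \<open>B\<close> and \<open>C\<close> are kept arbitrary.\<close>

lemma q_chu_vandermonde:
  fixes p B C :: "'a :: field"
  assumes "p \<noteq> 0" "B \<noteq> 0" "qpoch p p M \<noteq> 0" "qpoch C p M \<noteq> 0"
  shows "(\<Sum>i\<le>M. vandermonde_coeff p M i * qpoch B p i / qpoch C p i * (C / B) ^ i)
    = qpoch (C / B) p M / qpoch C p M"
  using assms
proof (induction M arbitrary: B C)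
  case 0
  show ?case by simp
next
  case (Suc M)
  have nz: "qpoch C p M \<noteq> 0" "qpoch (C * p) p M \<noteq> 0" "1 - C \<noteq> 0" "1 - C * p ^ M \<noteq> 0" "qpoch p p M \<noteq> 0"
    using Suc.prems(3,4) qpoch_Suc[of C p M] qpoch_Suc_left[of C p M] qpoch_Suc[of p p M] by auto
  have nzi: "qpoch p p (Suc i) \<noteq> 0" if "i \<le> M" for i
    using qpoch_neq_0_mono[OF Suc.prems(3)] that by simp
  let ?t = "\<lambda>M B C i. vandermonde_coeff p M i * qpoch B p i / qpoch C p i * (C / B) ^ i"
  have shift: "(\<Sum>i\<le>Suc M. g i) = g 0 + (\<Sum>i\<le>M. g (Suc i))" for g :: "nat \<Rightarrow> 'a"
    by (rule sum.atMost_Suc_shift)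
  have "(\<Sum>i\<le>Suc M. ?t (Suc M) B C i) = 1 + (\<Sum>i\<le>M. ?t (Suc M) B C (Suc i))"
    by (subst shift) simp
  also have "(\<Sum>i\<le>M. ?t (Suc M) B C (Suc i))
      = (\<Sum>i\<le>M. ?t M B C (Suc i) - p ^ M * (C / B) * (1 - B) / (1 - C) * ?t M (B * p) (C * p) i)"
  proof (intro sum.cong refl)
    fix i assume i: "i \<in> {..M}"
    have vc: "vandermonde_coeff p (Suc M) (Suc i)
        = vandermonde_coeff p M (Suc i) - p ^ M * vandermonde_coeff p M i"
      using nzi i by (intro vandermonde_coeff_pascal) auto
    have gen: "(V1 - P * V0) * (b1 * b) / (c1 * c) * (x * z)
        = V1 * (b1 * b) / (c1 * c) * (x * z) - P * x * b1 / c1 * (V0 * b / c * z)"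
      for V1 V0 P b1 b c1 c x z :: 'a
      by (simp add: left_diff_distrib diff_divide_distrib)
    show "?t (Suc M) B C (Suc i)
        = ?t M B C (Suc i) - p ^ M * (C / B) * (1 - B) / (1 - C) * ?t M (B * p) (C * p) i"
      using Suc.prems(1) unfolding vc qpoch_Suc_left[of C] qpoch_Suc_left[of B] power_Suc gen by simp
  qed
  also have "1 + \<dots> = (1 + (\<Sum>i\<le>M. ?t M B C (Suc i)))
      - p ^ M * (C / B) * (1 - B) / (1 - C) * (\<Sum>i\<le>M. ?t M (B * p) (C * p) i)"
    by (simp add: sum_subtractf sum_distrib_left)
  \<comment> \<open>The isolated \<open>1\<close> is the term \<open>i = 0\<close>, and the extra
    term \<open>i = M + 1\<close> vanishes.\<close>
  also have "1 + (\<Sum>i\<le>M. ?t M B C (Suc i)) = (\<Sum>i\<le>Suc M. ?t M B C i)"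
    by (subst shift) simp
  also have "\<dots> = (\<Sum>i\<le>M. ?t M B C i)"
    by (simp add: vandermonde_coeff_eq_0)
  also have "\<dots> = qpoch (C / B) p M / qpoch C p M"
    using Suc.IH[of B C] Suc.prems nz by blast
  also have "(\<Sum>i\<le>M. ?t M (B * p) (C * p) i) = qpoch (C / B) p M / qpoch (C * p) p M"
    using Suc.IH[of "B * p" "C * p"] Suc.prems nz by simp
  also have "qpoch (C * p) p M = qpoch C p M * (1 - C * p ^ M) / (1 - C)"
    using nz qpoch_Suc_left[of C p M] by (simp add: qpoch_Suc field_simps)
  also have "qpoch (C / B) p M / qpoch C p M - p ^ M * (C / B) * (1 - B) / (1 - C) *
      (qpoch (C / B) p M / (qpoch C p M * (1 - C * p ^ M) / (1 - C)))
      = qpoch (C / B) p (Suc M) / qpoch C p (Suc M)"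
    using nz Suc.prems by (simp add: qpoch_Suc divide_simps) (simp add: algebra_simps)
  finally show ?case .
qed

section \<open>Bailey's lemma, a Bailey pair and Watson's transformation\<close>

text \<open>Distributing \<open>1 / f = p ^ M\<close> over the factors links the terminating
  parameter to the numerator of \<open>vandermonde_coeff\<close>.\<close>

lemma qpoch_terminating_eq:
  fixes p f :: "'a :: field"
  assumes "f * p ^ M = 1" "i \<le> M"
  shows "qpoch f p i / f ^ i = (\<Prod>l<i. p ^ M - p ^ l)"
proof -
  have f: "f \<noteq> 0" using assms by auto
  then have *: "1 / f = p ^ M" using assms by (simp add: field_simps)
  have "qpoch f p i / f ^ i = (\<Prod>l<i. (1 - f * p ^ l) / f)"
    by (simp add: qpoch_def prod_dividef)
  also have "\<dots> = (\<Prod>l<i. p ^ M - p ^ l)"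
    using f by (simp add: diff_divide_distrib *)
  finally show ?thesis .
qed

text \<open>
  Bailey's lemma for a fixed index \<open>r\<close>. The parameter \<open>f\<close> plays the role of \<open>p\<^sup>-\<^sup>N\<close>, which makes the sum terminate.
\<close>

lemma bailey_coefficient_sum:
  fixes p a e f :: "'a :: field"
  assumes p: "p \<noteq> 0" and e: "e \<noteq> 0" and f: "f * p ^ N = 1" and r: "r \<le> N"
    and nz: "qpoch p p N \<noteq> 0" "qpoch (a * p) p (2 * N) \<noteq> 0" "qpoch (a * p / e) p N \<noteq> 0"
  shows "(\<Sum>j=r..N. qpoch e p j * qpoch f p j * (a * p / (e * f)) ^ j
      / (qpoch p p (j - r) * qpoch (a * p) p (j + r)))
    = qpoch (a * p / e) p N / qpoch (a * p) p N
      * (qpoch e p r * qpoch f p r / (qpoch (a * p / e) p r * qpoch (a * p / f) p r)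
      * (a * p / (e * f)) ^ r)"
proof -
  \<comment> \<open>With \<open>j = r + i\<close> every product splits after its first
    \<open>r\<close> or \<open>2 * r\<close> factors. What remains is a q-Chu-Vandermonde sum in
    \<open>B\<close> and \<open>C\<close>, with \<open>g\<close> as the terminating parameter for
    \<open>M\<close>.\<close>
  define M where "M = N - r"
  define B where "B = e * p ^ r"
  define C where "C = a * p * p ^ (2 * r)"
  define g where "g = f * p ^ r"
  have N: "N = r + M" using r by (simp add: M_def)
  have f0: "f \<noteq> 0" using f by auto
  have g: "g * p ^ M = 1" "g \<noteq> 0" using f f0 p by (simp_all add: g_def N power_add mult_ac)
  have CBg: "a * p / (e * f) = C / (B * g)"
    using p e f0 by (simp add: C_def B_def g_def power_mult power2_eq_square power_mult_distrib)
  let ?c = "qpoch e p r * qpoch f p r * (a * p / (e * f)) ^ r / qpoch (a * p) p (2 * r)"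
  have "(\<Sum>j=r..N. qpoch e p j * qpoch f p j * (a * p / (e * f)) ^ j
      / (qpoch p p (j - r) * qpoch (a * p) p (j + r)))
    = (\<Sum>i\<le>M. ?c * (vandermonde_coeff p M i * qpoch B p i / qpoch C p i * (C / B) ^ i))"
  proof (rule sum.reindex_bij_witness[of _ "\<lambda>i. i + r" "\<lambda>j. j - r"])
    fix j assume j: "j \<in> {r..N}"
    define i where "i = j - r"
    have ji: "j = r + i" "i \<le> M" using j by (auto simp: i_def M_def)
    have "vandermonde_coeff p M i * (C / B) ^ i = qpoch g p i / qpoch p p i * (C / (B * g)) ^ i"
      unfolding vandermonde_coeff_def qpoch_terminating_eq[OF g(1) ji(2), symmetric]
      by (simp add: power_divide power_mult_distrib)
    moreover have "qpoch (a * p) p (j + r) = qpoch (a * p) p (2 * r) * qpoch C p i"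
    proof -
      have "j + r = 2 * r + i" by (simp add: ji)
      then show ?thesis by (simp only: qpoch_add C_def)
    qed
    moreover have "qpoch e p j = qpoch e p r * qpoch B p i" "qpoch f p j = qpoch f p r * qpoch g p i"
      by (simp_all add: ji qpoch_add B_def g_def)
    ultimately show "?c * (vandermonde_coeff p M (j - r) * qpoch B p (j - r) / qpoch C p (j - r)
          * (C / B) ^ (j - r))
        = qpoch e p j * qpoch f p j * (a * p / (e * f)) ^ j
          / (qpoch p p (j - r) * qpoch (a * p) p (j + r))"
      unfolding i_def[symmetric] CBg[symmetric] by (simp add: power_add ji(1) mult_ac divide_inverse)
  qed (use r in \<open>auto simp: M_def\<close>)
  also have "\<dots> = ?c * (\<Sum>i\<le>M. vandermonde_coeff p M i * qpoch B p i / qpoch C p i * (C / B) ^ i)"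
    by (simp add: sum_distrib_left)
  also have "(\<Sum>i\<le>M. vandermonde_coeff p M i * qpoch B p i / qpoch C p i * (C / B) ^ i)
      = qpoch (C / B) p M / qpoch C p M"
  proof (rule q_chu_vandermonde)
    show "qpoch p p M \<noteq> 0" using nz(1) by (rule qpoch_neq_0_mono) (simp add: N)
    have "qpoch (a * p) p (2 * r + M) \<noteq> 0"
      using nz(2) by (rule qpoch_neq_0_mono) (simp add: N)
    then show "qpoch C p M \<noteq> 0" by (simp add: qpoch_add C_def)
  qed (use p e in \<open>auto simp: B_def\<close>)
  also have "qpoch (C / B) p M = qpoch (a * p / e) p N / qpoch (a * p / e) p r"
  proof -
    have "C / B = a * p / e * p ^ r"
      using p by (simp add: C_def B_def power_mult power2_eq_square power_mult_distrib)
    moreover have "qpoch (a * p / e) p r \<noteq> 0"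
      using nz(3) r by (rule qpoch_neq_0_mono)
    ultimately show ?thesis by (simp add: N qpoch_add)
  qed
  also have "qpoch C p M = qpoch (a * p) p N * qpoch (a * p / f) p r / qpoch (a * p) p (2 * r)"
  proof -
    \<comment> \<open>The same product is split at \<open>2 * r\<close> and at \<open>N\<close>.
      Because \<open>1 / f = p ^ N\<close>, the second splitting produces
      \<open>qpoch (a * p / f) p r\<close>.\<close>
    have 1: "qpoch (a * p) p (2 * r + M) = qpoch (a * p) p (2 * r) * qpoch C p M"
      by (simp add: qpoch_add C_def)
    have "1 / f = p ^ N" using f f0 by (simp add: field_simps)
    then have "a * p / f = a * p * p ^ N" by (metis times_divide_eq_right mult_1_right)
    then have 2: "qpoch (a * p) p (N + r) = qpoch (a * p) p N * qpoch (a * p / f) p r"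
      by (simp add: qpoch_add)
    have "2 * r + M = N + r" by (simp add: N)
    then have "qpoch C p M * qpoch (a * p) p (2 * r) = qpoch (a * p) p N * qpoch (a * p / f) p r"
      using 1 2 by (metis mult.commute)
    moreover have "qpoch (a * p) p (2 * r) \<noteq> 0"
      using nz(2) by (rule qpoch_neq_0_mono) (simp add: r)
    ultimately show ?thesis by (simp add: field_simps)
  qed
  also have "?c * (qpoch (a * p / e) p N / qpoch (a * p / e) p r
        / (qpoch (a * p) p N * qpoch (a * p / f) p r / qpoch (a * p) p (2 * r)))
    = qpoch (a * p / e) p N / qpoch (a * p) p N
      * (qpoch e p r * qpoch f p r / (qpoch (a * p / e) p r * qpoch (a * p / f) p r)
      * (a * p / (e * f)) ^ r)"
  proof -
    have "qpoch (a * p) p (2 * r) \<noteq> 0"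
      using nz(2) by (rule qpoch_neq_0_mono) (simp add: r)
    then show ?thesis by (simp add: mult_ac)
  qed
  finally show ?thesis .
qed

text \<open>
  The sequence \<open>\<alpha>\<^sub>r\<close> of a Bailey pair relative to \<open>a\<close>; \<open>wp_term_sum\<close> computes \<open>\<beta>\<^sub>j\<close>, which amounts to the
  terminating very-well-poised \<open>6\<phi>5\<close> summation.
\<close>

definition wp_term :: "'a :: field \<Rightarrow> 'a \<Rightarrow> 'a \<Rightarrow> 'a \<Rightarrow> nat \<Rightarrow> 'a" where
  "wp_term p a b c r = (1 - a * p ^ (2 * r)) / (1 - a)
     * (qpoch a p r * qpoch b p r * qpoch c p r
        / (qpoch p p r * qpoch (a * p / b) p r * qpoch (a * p / c) p r))
     * ((a * p / (b * c)) ^ r * (- 1) ^ r * p ^ (r choose 2))"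

text \<open>
  The polynomial identity behind the telescoping (WZ) proof of \<open>wp_term_sum\<close>, with \<open>X = p\<^sup>r\<close> and \<open>Y = p\<^sup>j\<^sup>+\<^sup>1\<close>.
\<close>

lemma wp_certificate:
  fixes a b c X Y :: "'a :: field"
  assumes "b \<noteq> 0" "c \<noteq> 0"
  shows "(1 - a * X^2) * (X * (1 - Y) * (1 - a * Y / b) * (1 - a * Y / c)
      - (1 - a * Y / (b * c)) * (X - Y) * (1 - a * Y * X))
    = Y * ((a / (b * c)) * (1 - a * X) * (1 - b * X) * (1 - c * X) * (X - Y)
      + (1 - X) * (1 - a * X / b) * (1 - a * X / c) * (1 - a * X * Y))"
  using assms by (simp add: divide_simps) (simp add: algebra_simps power2_eq_square)

text \<open>This is \<open>wp_certificate\<close> divided by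
  \<open>D * E * (1 - a * X * Y) * (1 - u)\<close>, using \<open>X - Y = (1 - u) * X\<close>. The
  left side is one normalised summand of the telescoping below, the right side the matching
  difference of its closed form.\<close>

lemma wp_step:
  fixes a b c X Y u :: "'a :: field"
  assumes "b \<noteq> 0" "c \<noteq> 0" "Y = u * X" "u \<noteq> 1" "1 - X \<noteq> 0" "1 - a * X / b \<noteq> 0" "1 - a * X / c \<noteq> 0"
    "1 - a * X * Y \<noteq> 0" "1 - Y \<noteq> 0" "1 - a * Y / b \<noteq> 0" "1 - a * Y / c \<noteq> 0"
  defines "D \<equiv> (1 - Y) * (1 - a * Y / b) * (1 - a * Y / c)"
  defines "E \<equiv> (1 - X) * (1 - a * X / b) * (1 - a * X / c)"
  shows "- X * (1 - a * X^2) / E * (1 / ((1 - u) * (1 - a * X * Y)) - (1 - a * Y / (b * c)) / D)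
    = - X * Y * (a / (b * c)) * ((1 - a * X) * (1 - b * X) * (1 - c * X)) / (D * E * (1 - a * X * Y))
      - Y / (D * (1 - u))"
proof -
  define F where "F = 1 - a * X * Y"
  define v where "v = 1 - u"
  define \<mu> where "\<mu> = 1 - a * Y / (b * c)"
  define W where "W = (a / (b * c)) * ((1 - a * X) * (1 - b * X) * (1 - c * X))"
  have nz: "D \<noteq> 0" "E \<noteq> 0" "F \<noteq> 0" "v \<noteq> 0" using assms(4-11) by (simp_all add: D_def E_def F_def v_def)
  have vX: "X - Y = v * X" by (simp add: v_def assms(3) algebra_simps)
  have "(1 - a * X^2) * (X * D - \<mu> * (X - Y) * F) = Y * (W * (X - Y) + E * F)"
    using wp_certificate[OF assms(1,2), of a X Y]
    by (simp only: D_def E_def F_def \<mu>_def W_def mult_ac)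
  then have *: "X * (1 - a * X^2) * (D - \<mu> * v * F) = Y * (W * v * X + E * F)"
    unfolding vX by (simp add: algebra_simps)
  have "- X * (1 - a * X^2) / E * (1 / (v * F) - \<mu> / D)
      = - (X * (1 - a * X^2) * (D - \<mu> * v * F)) / (D * E * F * v)"
    using nz by (simp add: divide_simps)
  also have "\<dots> = - X * Y * W / (D * E * F) - Y / (D * v)"
    unfolding * using nz by (simp add: divide_simps, simp add: algebra_simps)
  finally show ?thesis by (simp only: F_def v_def \<mu>_def W_def mult.assoc)
qed

lemma choose_two_Suc: "Suc r choose 2 = (r choose 2) + r"
  by (simp add: numeral_2_eq_2)

lemma wp_term_sum:
  fixes p a b c :: "'a :: field"
  assumes bc: "b \<noteq> 0" "c \<noteq> 0" and a: "a \<noteq> 1"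
    and nz: "qpoch p p j \<noteq> 0" "qpoch (a * p) p (2 * j) \<noteq> 0"
      "qpoch (a * p / b) p j \<noteq> 0" "qpoch (a * p / c) p j \<noteq> 0"
  shows "(\<Sum>r\<le>j. wp_term p a b c r / (qpoch p p (j - r) * qpoch (a * p) p (j + r)))
    = qpoch (a * p / (b * c)) p j / (qpoch p p j * qpoch (a * p / b) p j * qpoch (a * p / c) p j)"
  using nz
proof (induction j)
  case 0
  then show ?case using a by (simp add: wp_term_def numeral_2_eq_2)
next
  case (Suc j)
  define Y where "Y = p ^ Suc j"
  \<comment> \<open>\<open>\<rho>\<close> is the ratio of the claimed right-hand sides at
    \<open>Suc j\<close> and \<open>j\<close>, so the sum has to grow by this factor.\<close>
  define \<rho> where "\<rho> = (1 - a * Y / (b * c)) / ((1 - Y) * (1 - a * Y / b) * (1 - a * Y / c))"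
  let ?w = "\<lambda>j r. qpoch p p (j - r) * qpoch (a * p) p (j + r)"
  \<comment> \<open>The WZ companion: a closed form for the partial sums of the summand at
    \<open>Suc j\<close> minus \<open>\<rho>\<close> times the summand at \<open>j\<close>.\<close>
  define H where "H r = Y * (a / (b * c)) / ((1 - Y) * (1 - a * Y / b) * (1 - a * Y / c))
    * (qpoch a p (Suc r) * qpoch b p (Suc r) * qpoch c p (Suc r)
       / ((1 - a) * (qpoch p p r * qpoch (a * p / b) p r * qpoch (a * p / c) p r)))
    * ((a * p / (b * c)) ^ r * (- 1) ^ r * p ^ (r choose 2))
    / (qpoch p p (j - r) * qpoch (a * p) p (Suc (j + r)))" for r
  have Yb: "a * p / b * p ^ j = a * Y / b" "a * p / c * p ^ j = a * Y / c"
     "a * p / (b * c) * p ^ j = a * Y / (b * c)" "p * p ^ j = Y" by (simp_all add: Y_def)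
  have nzY: "1 - Y \<noteq> 0" "1 - a * Y / b \<noteq> 0" "1 - a * Y / c \<noteq> 0"
    using Suc.prems by (auto simp: qpoch_Suc Yb)
  have nzj: "qpoch p p j \<noteq> 0" "qpoch (a * p / b) p j \<noteq> 0" "qpoch (a * p / c) p j \<noteq> 0"
    using Suc.prems by (auto simp: qpoch_Suc)
  have nza: "qpoch (a * p) p i \<noteq> 0" if "i \<le> 2 * j + 2" for i
    using qpoch_neq_0_mono[OF Suc.prems(2), of i] that by simp
  have IH: "(\<Sum>r\<le>j. wp_term p a b c r / ?w j r)
    = qpoch (a * p / (b * c)) p j / (qpoch p p j * qpoch (a * p / b) p j * qpoch (a * p / c) p j)"
    using Suc.IH nzj nza by simp
  have tel: "(\<Sum>r\<le>R. wp_term p a b c r * (1 / ?w (Suc j) r - \<rho> / ?w j r)) = H R" if "R \<le> j" for R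
    using that
  proof (induction R)
    case 0
    have *: "(1 - a * Y / b) * (1 - a * Y / c) - (1 - a * Y / (b * c)) * (1 - a * Y)
        = Y * (a / (b * c)) * ((1 - b) * (1 - c))"
      using bc by (simp add: divide_simps) (simp add: algebra_simps)
    have w: "?w (Suc j) 0 = (1 - Y) * (1 - a * Y) * ?w j 0" "1 - a * Y \<noteq> 0" "?w j 0 \<noteq> 0"
      using nzj nza[of "Suc j"] by (auto simp: qpoch_Suc Y_def mult_ac)
    have "1 / ?w (Suc j) 0 - \<rho> / ?w j 0
        = ((1 - a * Y / b) * (1 - a * Y / c) - (1 - a * Y / (b * c)) * (1 - a * Y))
          / ((1 - Y) * (1 - a * Y / b) * (1 - a * Y / c) * (1 - a * Y) * ?w j 0)"
    proof -
      define e1 where "e1 = 1 - a * Y / b"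
      define e2 where "e2 = 1 - a * Y / c"
      have "e1 \<noteq> 0" "e2 \<noteq> 0" using nzY by (simp_all add: e1_def e2_def)
      then show ?thesis
        unfolding w(1) \<rho>_def e1_def[symmetric] e2_def[symmetric] using nzY(1) w(2,3)
        by (simp add: divide_simps)
    qed
    also have "\<dots> = H 0" unfolding * H_def
      using a by (simp add: qpoch_Suc numeral_2_eq_2 Y_def mult_ac)
    finally show ?case using a by (simp add: wp_term_def numeral_2_eq_2)
  next
    case (Suc R)
    define X where "X = p ^ Suc R"
    define u where "u = p ^ Suc (j - Suc R)"
    define \<kappa> where "\<kappa> = a / (b * c)"
    define Q where "Q = (a * p / (b * c)) ^ R * (- 1) ^ R * p ^ (R choose 2)"
    define P where "P = qpoch a p (Suc R) * qpoch b p (Suc R) * qpoch c p (Suc R)"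
    define V where "V = qpoch p p R * qpoch (a * p / b) p R * qpoch (a * p / c) p R"
    define W where "W = ?w j (Suc R)"
    define D where "D = (1 - Y) * (1 - a * Y / b) * (1 - a * Y / c)"
    define E where "E = (1 - X) * (1 - a * X / b) * (1 - a * X / c)"
    define C where "C = \<kappa> * Q * P / ((1 - a) * V * W)"
    have Yu: "Y = u * X" using Suc.prems by (simp add: Y_def u_def X_def flip: power_add power_Suc)
    have Xb: "a * p / b * p ^ R = a * X / b" "a * p / c * p ^ R = a * X / c" "p * p ^ R = X"
      by (simp_all add: X_def)
    have Q': "(a * p / (b * c)) ^ Suc R * (- 1) ^ Suc R * p ^ (Suc R choose 2) = - (\<kappa> * X) * Q"
      by (simp add: Q_def choose_two_Suc power_add X_def \<kappa>_def)
    have V': "qpoch p p (Suc R) * qpoch (a * p / b) p (Suc R) * qpoch (a * p / c) p (Suc R) = V * E"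
      unfolding V_def E_def qpoch_Suc Xb by (simp only: mult_ac)
    have P': "qpoch a p (Suc (Suc R)) * qpoch b p (Suc (Suc R)) * qpoch c p (Suc (Suc R))
       = P * ((1 - a * X) * (1 - b * X) * (1 - c * X))"
      unfolding P_def X_def qpoch_Suc[of _ _ "Suc R"] by (simp only: mult_ac)
    have W1: "?w (Suc j) (Suc R) = W * ((1 - u) * (1 - a * X * Y))"
    proof -
      have "Suc j - Suc R = Suc (j - Suc R)" "Suc j + Suc R = Suc (j + Suc R)" using Suc.prems by simp_all
      moreover have "a * p * p ^ (j + Suc R) = a * X * Y" by (simp add: X_def Y_def power_add)
      moreover have "p * p ^ (j - Suc R) = u" by (simp add: u_def)
      ultimately show ?thesis unfolding W_def by (simp only: qpoch_Suc mult_ac)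
    qed
    have W2: "qpoch p p (j - Suc R) * qpoch (a * p) p (Suc (j + Suc R)) = W * (1 - a * X * Y)"
    proof -
      have "a * p * p ^ (j + Suc R) = a * X * Y" by (simp add: X_def Y_def power_add)
      then show ?thesis unfolding W_def by (simp only: qpoch_Suc mult_ac)
    qed
    have W3: "qpoch p p (j - R) * qpoch (a * p) p (Suc (j + R)) = W * (1 - u)"
    proof -
      have "j - R = Suc (j - Suc R)" using Suc.prems by simp
      moreover have "p * p ^ (j - Suc R) = u" by (simp add: u_def)
      ultimately show ?thesis unfolding W_def by (simp only: qpoch_Suc mult_ac add_Suc_right)
    qed
    have nzp: "qpoch p p i \<noteq> 0" if "i \<le> j" for i using nzj(1) that by (rule qpoch_neq_0_mono)
    have nzb: "qpoch (a * p / b) p i \<noteq> 0" if "i \<le> j" for i using nzj(2) that by (rule qpoch_neq_0_mono)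
    have nzc: "qpoch (a * p / c) p i \<noteq> 0" if "i \<le> j" for i using nzj(3) that by (rule qpoch_neq_0_mono)
    have "V * E \<noteq> 0" unfolding V'[symmetric] using nzp nzb nzc Suc.prems by simp
    then have E0: "V \<noteq> 0" "1 - X \<noteq> 0" "1 - a * X / b \<noteq> 0" "1 - a * X / c \<noteq> 0" by (auto simp: E_def)
    have "W * (1 - u) \<noteq> 0" "W * (1 - a * X * Y) \<noteq> 0"
      unfolding W2[symmetric] W3[symmetric] using nzp nza Suc.prems by simp_all
    then have u0: "W \<noteq> 0" "u \<noteq> 1" "1 - a * X * Y \<noteq> 0" by auto
    have X2: "p ^ (2 * Suc R) = X ^ 2" unfolding X_def by (simp only: power_mult[symmetric] mult.commute)
    have gen0: "1 / (W * t) - s / W = (1 / t - s) / W" for s t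
      by (simp add: diff_divide_distrib mult.commute)
    have gen1: "m / l * (P / (V * E)) * (- (\<kappa> * X) * Q) * (t / W) = \<kappa> * Q * P / (l * V * W) * (- X * m / E * t)"
      for m l t
      by (simp add: mult_ac)
    have gen2: "\<kappa> * Q * P / (l * V * W) * (- X * Y * \<kappa> * z / (D * E * t) - Y / (D * s))
        = Y * \<kappa> / D * (P * z / (l * (V * E))) * (- (\<kappa> * X) * Q) / (W * t)
          - Y * \<kappa> / D * (P / (l * V)) * Q / (W * s)"
      for l t z s
      by (simp add: right_diff_distrib mult_ac)
    have "wp_term p a b c (Suc R) = (1 - a * X^2) / (1 - a) * (P / (V * E)) * (- (\<kappa> * X) * Q)"
      unfolding wp_term_def X2 P_def[symmetric] V' Q' ..
    then have "wp_term p a b c (Suc R) * (1 / ?w (Suc j) (Suc R) - \<rho> / ?w j (Suc R))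
        = C * (- X * (1 - a * X^2) / E * (1 / ((1 - u) * (1 - a * X * Y)) - (1 - a * Y / (b * c)) / D))"
      unfolding W1 W_def[symmetric] \<rho>_def D_def[symmetric] C_def
      by (simp only: gen0 gen1)
    also have "\<dots> = C * (- X * Y * \<kappa> * ((1 - a * X) * (1 - b * X) * (1 - c * X)) / (D * E * (1 - a * X * Y))
        - Y / (D * (1 - u)))"
      using wp_step[OF bc Yu u0(2) E0(2-4) u0(3) nzY] by (simp only: D_def E_def \<kappa>_def)
    also have "\<dots> = H (Suc R) - H R"
      unfolding H_def W2 W3 P' Q' V' P_def[symmetric] V_def[symmetric] Q_def[symmetric] \<kappa>_def[symmetric]
        D_def[symmetric] C_def by (rule gen2)
    finally show ?case using Suc by simp
  qed
  \<comment> \<open>The index \<open>Suc j\<close> occurs only in the longer sum, and its term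
    cancels the telescoped value \<open>H j\<close>.\<close>
  have last: "wp_term p a b c (Suc j) / ?w (Suc j) (Suc j) = - H j"
  proof -
    have "a * p * p ^ Suc (2 * j) = a * Y^2"
      by (simp add: Y_def power2_eq_square mult_2 power_add)
    then have 1: "qpoch (a * p) p (Suc j + Suc j) = qpoch (a * p) p (Suc (j + j)) * (1 - a * Y^2)"
      by (simp add: mult_2 qpoch_Suc[of _ _ "Suc (j + j)"])
    have 2: "1 - a * Y^2 \<noteq> 0" using nza[of "Suc j + Suc j"] unfolding 1 by simp
    have 3: "p ^ (2 * Suc j) = Y ^ 2" unfolding Y_def by (simp only: power_mult[symmetric] mult.commute)
    have 4: "(a * p / (b * c)) ^ Suc j * (- 1) ^ Suc j * p ^ (Suc j choose 2)
        = - (Y * (a / (b * c))) * ((a * p / (b * c)) ^ j * (- 1) ^ j * p ^ (j choose 2))"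
      by (simp add: choose_two_Suc power_add Y_def)
    have 5: "qpoch p p (Suc j) * qpoch (a * p / b) p (Suc j) * qpoch (a * p / c) p (Suc j)
        = ((1 - Y) * (1 - a * Y / b) * (1 - a * Y / c)) * (qpoch p p j * qpoch (a * p / b) p j * qpoch (a * p / c) p j)"
      unfolding qpoch_Suc Yb by (simp only: mult_ac)
    show ?thesis
      unfolding wp_term_def 1 3 H_def 5 4 using 2 by (simp add: mult_ac)
  qed
  have "(\<Sum>r\<le>Suc j. wp_term p a b c r / ?w (Suc j) r)
      = (\<Sum>r\<le>j. wp_term p a b c r / ?w (Suc j) r) - H j"
    by (simp only: sum.atMost_Suc last) simp
  also have "\<dots> = (\<Sum>r\<le>j. wp_term p a b c r / ?w (Suc j) r)
       - (\<Sum>r\<le>j. wp_term p a b c r * (1 / ?w (Suc j) r - \<rho> / ?w j r))"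
    using tel[of j] by simp
  also have "\<dots> = \<rho> * (\<Sum>r\<le>j. wp_term p a b c r / ?w j r)"
    by (simp add: sum_distrib_left flip: sum_subtractf) (simp add: algebra_simps)
  also have "\<dots> = qpoch (a * p / (b * c)) p (Suc j)
     / (qpoch p p (Suc j) * qpoch (a * p / b) p (Suc j) * qpoch (a * p / c) p (Suc j))"
    unfolding IH \<rho>_def qpoch_Suc Yb by (simp add: mult_ac)
  finally show ?case .
qed


text \<open>
  Watson's transformation with one of its parameters sent to infinity.
\<close>

lemma watson_limit:
  fixes p a b c e f :: "'a :: field"
  assumes "p \<noteq> 0" "a \<noteq> 1" "b \<noteq> 0" "c \<noteq> 0" "e \<noteq> 0" "f * p ^ N = 1"
    and nz: "qpoch p p N \<noteq> 0" "qpoch (a * p) p (2 * N) \<noteq> 0"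
      "qpoch (a * p / b) p N \<noteq> 0" "qpoch (a * p / c) p N \<noteq> 0" "qpoch (a * p / e) p N \<noteq> 0"
  shows "qpoch (a * p / e) p N / qpoch (a * p) p N
      * (\<Sum>r\<le>N. wp_term p a b c r * (qpoch e p r * qpoch f p r
          / (qpoch (a * p / e) p r * qpoch (a * p / f) p r) * (a * p / (e * f)) ^ r))
    = (\<Sum>j\<le>N. qpoch e p j * qpoch f p j * (a * p / (e * f)) ^ j
        * (qpoch (a * p / (b * c)) p j
            / (qpoch p p j * qpoch (a * p / b) p j * qpoch (a * p / c) p j)))"
proof -
  let ?g = "\<lambda>j. qpoch e p j * qpoch f p j * (a * p / (e * f)) ^ j"
  let ?w = "\<lambda>j r. qpoch p p (j - r) * qpoch (a * p) p (j + r)"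
  \<comment> \<open>The factor beside each \<open>wp_term\<close> is expanded into a sum over
    \<open>j\<close> by \<open>bailey_coefficient_sum\<close>. After exchanging the sums,
    \<open>wp_term_sum\<close> evaluates the inner one.\<close>
  have "qpoch (a * p / e) p N / qpoch (a * p) p N
      * (\<Sum>r\<le>N. wp_term p a b c r * (qpoch e p r * qpoch f p r
          / (qpoch (a * p / e) p r * qpoch (a * p / f) p r) * (a * p / (e * f)) ^ r))
    = (\<Sum>r\<le>N. wp_term p a b c r * (\<Sum>j=r..N. ?g j / ?w j r))"
    unfolding sum_distrib_left[of _ _ "{..N}"]
  proof (intro sum.cong refl)
    fix r assume "r \<in> {..N}"
    then have "(\<Sum>j=r..N. ?g j / ?w j r) = qpoch (a * p / e) p N / qpoch (a * p) p N
      * (qpoch e p r * qpoch f p r / (qpoch (a * p / e) p r * qpoch (a * p / f) p r)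
      * (a * p / (e * f)) ^ r)"
      using assms by (intro bailey_coefficient_sum) auto
    then show "qpoch (a * p / e) p N / qpoch (a * p) p N
      * (wp_term p a b c r * (qpoch e p r * qpoch f p r
          / (qpoch (a * p / e) p r * qpoch (a * p / f) p r) * (a * p / (e * f)) ^ r))
      = wp_term p a b c r * (\<Sum>j=r..N. ?g j / ?w j r)"
      by (simp only: mult.left_commute)
  qed
  also have "\<dots> = (\<Sum>r\<le>N. \<Sum>j=r..N. wp_term p a b c r * (?g j / ?w j r))"
    by (simp only: sum_distrib_left)
  also have "\<dots> = (\<Sum>j\<le>N. \<Sum>r\<le>j. wp_term p a b c r * (?g j / ?w j r))"
    by (subst sum.Sigma, simp, simp, subst sum.Sigma, simp, simp,
        rule sum.reindex_bij_witness[of _ prod.swap prod.swap]) auto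
  also have "\<dots> = (\<Sum>j\<le>N. ?g j * (\<Sum>r\<le>j. wp_term p a b c r / ?w j r))"
    by (simp add: sum_distrib_left mult_ac)
  also have "\<dots> = (\<Sum>j\<le>N. ?g j * (qpoch (a * p / (b * c)) p j
            / (qpoch p p j * qpoch (a * p / b) p j * qpoch (a * p / c) p j)))"
  proof (intro sum.cong refl)
    fix j assume j: "j \<in> {..N}"
    show "?g j * (\<Sum>r\<le>j. wp_term p a b c r / ?w j r)
      = ?g j * (qpoch (a * p / (b * c)) p j
            / (qpoch p p j * qpoch (a * p / b) p j * qpoch (a * p / c) p j))"
      using assms j nz[THEN qpoch_neq_0_mono] by (subst wp_term_sum) auto
  qed
  finally show ?thesis .
qed

section \<open>The deformed sums as a case of Watson's transformation\<close>

text \<open>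
  By \<open>qpoch_mult_qpoch_eq_qpoch2\<close> below this is \<open>(t x; p)\<^sub>k (x/t; p)\<^sub>k\<close> for \<open>y = t + 1/t\<close>.
\<close>

definition qpoch2 :: "'a :: comm_ring_1 \<Rightarrow> 'a \<Rightarrow> 'a \<Rightarrow> nat \<Rightarrow> 'a" where
  "qpoch2 y x p k = (\<Prod>j<k. 1 - y * (x * p ^ j) + (x * p ^ j)\<^sup>2)"

lemma qpoch_mult_qpoch_eq_qpoch2:
  fixes t x p :: "'a :: field"
  assumes "t \<noteq> 0"
  shows "qpoch (t * x) p k * qpoch (x / t) p k = qpoch2 (t + 1 / t) x p k"
  unfolding qpoch_def qpoch2_def prod.distrib[symmetric]
  by (intro prod.cong refl) (use assms in \<open>simp add: field_simps power2_eq_square\<close>)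

lemma qpoch2_2: "qpoch2 2 x p k = (qpoch x p k)\<^sup>2"
  unfolding qpoch_def qpoch2_def prod_power_distrib
  by (intro prod.cong refl) (simp add: field_simps power2_eq_square)

text \<open>The monomial \<open>- z ^ (2 * j + 1)\<close> is taken out of each factor. The exponents
  1, 3, ..., 2t - 1 add up to \<open>t\<^sup>2\<close>, and the remaining factors come in reverse
  order.\<close>

lemma qpoch_reverse_odd:
  fixes z :: "'a :: field"
  assumes "z \<noteq> 0"
  shows "qpoch z (z\<^sup>2) t = (- 1) ^ t * z ^ t\<^sup>2 * qpoch (z / (z\<^sup>2) ^ t) (z\<^sup>2) t"
proof (induction t)
  case 0
  show ?case by simp
next
  case (Suc t)
  have 1: "1 - z * (z\<^sup>2) ^ t = - (z * (z\<^sup>2) ^ t) * (1 - z / (z\<^sup>2) ^ Suc t)"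
    using assms by (simp add: field_simps power2_eq_square)
  have 2: "z / (z\<^sup>2) ^ Suc t * z\<^sup>2 = z / (z\<^sup>2) ^ t"
    using assms by simp
  have "z ^ (Suc t)\<^sup>2 = z ^ t\<^sup>2 * (z * (z\<^sup>2) ^ t)"
    by (simp add: power2_eq_square power_add power_mult_distrib mult_ac flip: power_mult)
  then show ?case
    unfolding qpoch_Suc_left[of "z / (z\<^sup>2) ^ Suc t"] qpoch_Suc[of z] 1 2 Suc.IH
    by (simp add: mult_ac)
qed

text \<open>
  The deformed summands as functions of \<open>z\<close>, the value of \<open>q\<close>, and of \<open>y\<close>; the theorem is the case \<open>y = 2\<close>.
\<close>

definition lhs_term :: "'a :: field \<Rightarrow> 'a \<Rightarrow> nat \<Rightarrow> 'a" where
  "lhs_term z y k = (- 1) ^ k * ((1 - z powi (4 * int k - 1)) / (1 - z))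
     * (qpoch (inverse z) (z\<^sup>2) k ^ 3 * qpoch2 y (inverse z) (z\<^sup>2) k
        / (qpoch (z\<^sup>2) (z\<^sup>2) k ^ 3 * qpoch2 y (z\<^sup>2) (z\<^sup>2) k)) * z ^ (k\<^sup>2 + 5 * k)"

definition rhs_sum :: "'a :: field \<Rightarrow> 'a \<Rightarrow> nat \<Rightarrow> 'a" where
  "rhs_sum z y N = (\<Sum>k\<le>N. qpoch2 y (inverse z) (z\<^sup>2) k * qpoch (z ^ 3) (z\<^sup>2) k
     / qpoch (z\<^sup>2) (z\<^sup>2) k ^ 3 * z ^ (3 * k))"

text \<open>Base \<open>z\<^sup>2\<close> with \<open>a = b = c = 1 / z\<close>,
  \<open>e = x / z\<close> and \<open>f = 1 / (x * z)\<close>: then \<open>a * p = z\<close>, and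
  both \<open>a * p / (b * c)\<close> and \<open>a * p / (e * f)\<close> equal \<open>z ^ 3\<close>.
  The factor \<open>- (1 / z)\<close> comes from rewriting the q-integer.\<close>

lemma lhs_term_eq_wp_term:
  fixes z x :: "'a :: field"
  assumes "z \<noteq> 0" "z \<noteq> 1" "x \<noteq> 0"
  shows "lhs_term z (x + 1 / x) k = - (1 / z) * (wp_term (z\<^sup>2) (inverse z) (inverse z) (inverse z) k
    * (qpoch (x * inverse z) (z\<^sup>2) k * qpoch (inverse z / x) (z\<^sup>2) k
       / (qpoch (z\<^sup>2 / x) (z\<^sup>2) k * qpoch (x * z\<^sup>2) (z\<^sup>2) k) * (z ^ 3) ^ k))"
proof -
  have "2 * (k choose 2) + k = k\<^sup>2"
    by (cases k) (simp_all add: choose_two power2_eq_square)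
  \<comment> \<open>One \<open>3 * k\<close> belongs to \<open>a * p / (b * c)\<close>, the other to
    \<open>a * p / (e * f)\<close>, and the middle term to \<open>p ^ (k choose 2)\<close>.\<close>
  then have e: "k\<^sup>2 + 5 * k = 3 * k + 2 * (k choose 2) + 3 * k" by simp
  have pw: "z ^ (k\<^sup>2 + 5 * k) = (z ^ 3) ^ k * (z\<^sup>2) ^ (k choose 2) * (z ^ 3) ^ k"
    unfolding e by (simp only: power_add power_mult)
  have "z powi (4 * int k - 1) = inverse z * z ^ (4 * k)"
    using assms by (simp add: power_int_diff field_simps flip: power_int_of_nat)
  also have "z ^ (4 * k) = (z\<^sup>2) ^ (2 * k)" by (simp flip: power_mult)
  finally have qi: "(1 - z powi (4 * int k - 1)) / (1 - z)
     = - (1 / z) * ((1 - inverse z * (z\<^sup>2) ^ (2 * k)) / (1 - inverse z))"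
    using assms by (simp add: field_simps)
  have s: "inverse z * z\<^sup>2 / inverse z = z\<^sup>2" "inverse z * z\<^sup>2 / (inverse z * inverse z) = z ^ 3"
    using assms by (simp_all add: field_simps power2_eq_square power3_eq_cube)
  show ?thesis
    unfolding lhs_term_def wp_term_def qi pw s qpoch_mult_qpoch_eq_qpoch2[OF assms(3), symmetric]
    by (simp add: power3_eq_cube mult_ac)
qed

text \<open>
  Here \<open>n = 2 t + 1\<close>, and the terminating parameter \<open>1 / (x z) = z\<^sup>-\<^sup>n\<^sup>-\<^sup>1\<close> is \<open>(z\<^sup>2)\<^sup>-\<^sup>(\<^sup>t\<^sup>+\<^sup>1\<^sup>)\<close>.
\<close>

lemma watson_specialised:
  fixes z :: "'a :: field"
  assumes z: "z \<noteq> 0" and t: "t > 0" and nz: "\<And>i. 0 < i \<Longrightarrow> i \<le> 4 * t + 3 \<Longrightarrow> z ^ i \<noteq> 1"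
  defines "x \<equiv> z ^ (2 * t + 1)"
  shows "(\<Sum>k\<le>t + 1. lhs_term z (x + 1 / x) k)
    = (1 - x) / (1 - z) * (- z) ^ (t\<^sup>2 - 1) * rhs_sum z (x + 1 / x) (t + 1)"
proof -
  have x: "x \<noteq> 0" using z by (simp add: x_def)
  have z1: "z \<noteq> 1" using nz[of 1] by simp
  let ?N = "t + 1"
  have s: "inverse z * z\<^sup>2 = z" "z / inverse z = z\<^sup>2" "z / (inverse z * inverse z) = z ^ 3"
      "z / (x * inverse z) = z\<^sup>2 / x" "z / (inverse z / x) = x * z\<^sup>2"
      "z / (x * inverse z * (inverse z / x)) = z ^ 3"
    using z x by (simp_all add: field_simps power2_eq_square power3_eq_cube)
  have nz1: "qpoch (z\<^sup>2) (z\<^sup>2) ?N \<noteq> 0"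
  proof -
    have *: "z\<^sup>2 * (z\<^sup>2) ^ j = z ^ (2 * j + 2)" for j
      by (simp only: power_add power_mult mult.commute[of "z\<^sup>2"])
    have "z\<^sup>2 * (z\<^sup>2) ^ j \<noteq> 1" if "j < ?N" for j
      unfolding * by (rule nz) (use that in simp_all)
    then show ?thesis by (simp add: qpoch_def)
  qed
  \<comment> \<open>The last factor has exponent \<open>2 * (2 * t + 1) + 1 = 4 * t + 3\<close>, the
    bound in the hypothesis on \<open>z\<close>.\<close>
  have nz2: "qpoch z (z\<^sup>2) (2 * ?N) \<noteq> 0"
  proof -
    have "z * (z\<^sup>2) ^ j = z ^ (Suc (2 * j))" for j by (simp only: power_Suc power_mult)
    then show ?thesis using nz by (auto simp: qpoch_def simp del: power_Suc)
  qed
  have zx: "z\<^sup>2 / x = z / (z\<^sup>2) ^ t"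
    using z by (simp add: x_def power2_eq_square power_mult power_mult_distrib)
  \<comment> \<open>Reversal matches the first \<open>t\<close> factors of the two products. The
    last factors are \<open>1 - x\<close> and \<open>1 - z\<close>, and their quotient is the
    q-integer of \<open>n\<close>.\<close>
  have rev: "qpoch z (z\<^sup>2) ?N = (- 1) ^ t * z ^ t\<^sup>2 * ((1 - x) / (1 - z)) * qpoch (z\<^sup>2 / x) (z\<^sup>2) ?N"
  proof -
    have "z / (z\<^sup>2) ^ t * (z\<^sup>2) ^ t = z" "z * (z\<^sup>2) ^ t = x"
      using z by (simp_all add: x_def power_mult)
    moreover have "A * Z * P = A * (P / W) * (Z * W)" if "W \<noteq> 0" for A Z P W :: 'a
      using that by simp
    ultimately show ?thesis
      unfolding zx Suc_eq_plus1[symmetric] qpoch_Suc qpoch_reverse_odd[OF z, of t]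
      using z1 by simp
  qed
  have nz3: "qpoch (z\<^sup>2 / x) (z\<^sup>2) ?N \<noteq> 0"
  proof -
    have "qpoch z (z\<^sup>2) ?N \<noteq> 0" using nz2 by (rule qpoch_neq_0_mono) simp
    then show ?thesis unfolding rev by auto
  qed
  let ?S = "\<Sum>r\<le>?N. wp_term (z\<^sup>2) (inverse z) (inverse z) (inverse z) r
    * (qpoch (x * inverse z) (z\<^sup>2) r * qpoch (inverse z / x) (z\<^sup>2) r
       / (qpoch (z\<^sup>2 / x) (z\<^sup>2) r * qpoch (x * z\<^sup>2) (z\<^sup>2) r) * (z ^ 3) ^ r)"
  have fN: "inverse z / x * (z\<^sup>2) ^ ?N = 1"
  proof -
    have "(z\<^sup>2) ^ ?N = z * x" by (simp add: x_def power2_eq_square power_mult_distrib mult_2 power_add)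
    then show ?thesis using z x by simp
  qed
  have solve: "S = B / A * R" if "A / B * S = R" "A \<noteq> 0" "B \<noteq> 0" for A B S R :: 'a
    using that by (auto simp: field_simps)
  have "qpoch (z\<^sup>2 / x) (z\<^sup>2) ?N / qpoch z (z\<^sup>2) ?N * ?S
    = (\<Sum>j\<le>?N. qpoch (x * inverse z) (z\<^sup>2) j * qpoch (inverse z / x) (z\<^sup>2) j * (z ^ 3) ^ j
        * (qpoch (z ^ 3) (z\<^sup>2) j / (qpoch (z\<^sup>2) (z\<^sup>2) j * qpoch (z\<^sup>2) (z\<^sup>2) j * qpoch (z\<^sup>2) (z\<^sup>2) j)))"
    by (rule watson_limit[of "z\<^sup>2" "inverse z" "inverse z" "inverse z" "x * inverse z" "inverse z / x" ?N,
        unfolded s]) (use nz1 nz2 nz3 z z1 x fN in simp_all)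
  also have "\<dots> = rhs_sum z (x + 1 / x) ?N"
    unfolding rhs_sum_def qpoch_mult_qpoch_eq_qpoch2[OF x, symmetric] power_mult
      power3_eq_cube[of "qpoch _ _ _"]
    by (intro sum.cong refl) simp
  finally have "?S = qpoch z (z\<^sup>2) ?N / qpoch (z\<^sup>2 / x) (z\<^sup>2) ?N * rhs_sum z (x + 1 / x) ?N"
    by (rule solve) (use nz2[THEN qpoch_neq_0_mono, of ?N] nz3 in simp_all)
  also have "\<dots> = (- 1) ^ t * z ^ t\<^sup>2 * ((1 - x) / (1 - z)) * rhs_sum z (x + 1 / x) ?N"
    unfolding rev using nz3 by simp
  finally have S: "?S = (- 1) ^ t * z ^ t\<^sup>2 * ((1 - x) / (1 - z)) * rhs_sum z (x + 1 / x) ?N" .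
  \<comment> \<open>By \<open>t > 0\<close> the subtraction is not truncated. The prefactor
    \<open>- (1 / z)\<close> lowers the exponent by one, and the signs agree because
    \<open>t\<close> and \<open>t\<^sup>2\<close> have the same parity.\<close>
  have "Suc (t\<^sup>2 - 1) = t\<^sup>2" using t by simp
  then have "(- z) ^ t\<^sup>2 = - z * (- z) ^ (t\<^sup>2 - 1)"
    using power_Suc[of "- z" "t\<^sup>2 - 1"] by (simp only:)
  moreover have "(- z) ^ t\<^sup>2 = (- 1) ^ t * z ^ t\<^sup>2"
    using power_minus[of z "t\<^sup>2"] by (cases "even t") simp_all
  ultimately have sg: "- (1 / z) * ((- 1) ^ t * z ^ t\<^sup>2) = (- z) ^ (t\<^sup>2 - 1)"
    using z by simp
  have "(\<Sum>k\<le>t + 1. lhs_term z (x + 1 / x) k) = - (1 / z) * ?S"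
    unfolding sum_distrib_left by (intro sum.cong refl lhs_term_eq_wp_term z z1 x)
  also have "\<dots> = (- (1 / z) * ((- 1) ^ t * z ^ t\<^sup>2)) * ((1 - x) / (1 - z) * rhs_sum z (x + 1 / x) ?N)"
    unfolding S by (simp only: mult_ac)
  finally show ?thesis unfolding sg by (simp only: mult_ac)
qed

section \<open>Rational functions as functions of a complex variable\<close>

abbreviation cpoly :: "int poly \<Rightarrow> complex poly" where
  "cpoly \<equiv> map_poly of_int"

text \<open>
  Finitely many exceptional points are allowed, so that poles and the junk values of division in \<open>\<complex>\<close> do not matter.
\<close>

definition represents :: "int poly fract \<Rightarrow> (complex \<Rightarrow> complex) \<Rightarrow> bool" where
  "represents A f \<longleftrightarrow> (\<exists>U V. V \<noteq> 0 \<and> A * to_fract V = to_fract U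
     \<and> (\<forall>\<^sub>F z in cofinite. f z * poly (cpoly V) z = poly (cpoly U) z))"

lemma cpoly_eq_0_iff: "cpoly p = 0 \<longleftrightarrow> p = 0"
  using map_poly_of_int_eq_iff[of p 0] by simp

lemma eventually_cofinite_poly_neq_0:
  assumes "V \<noteq> 0"
  shows "\<forall>\<^sub>F z in cofinite. poly (cpoly V) z \<noteq> 0"
  using poly_roots_finite[of "cpoly V"] assms by (simp add: eventually_cofinite cpoly_eq_0_iff)

lemma represents_to_fract:
  assumes "\<And>z. poly (cpoly p) z = f z"
  shows "represents (to_fract p) f"
  unfolding represents_def by (rule exI[of _ p], rule exI[of _ 1]) (simp add: assms)

lemma represents_q: "represents q (\<lambda>z. z)"
  unfolding q_def by (rule represents_to_fract) (simp add: map_poly_pCons)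

lemma represents_0: "represents 0 (\<lambda>_. 0)"
  using represents_to_fract[of 0 "\<lambda>_. 0"] by simp

lemma represents_1: "represents 1 (\<lambda>_. 1)"
  using represents_to_fract[of 1 "\<lambda>_. 1"] by simp

lemma represents_add:
  assumes "represents A f" "represents B g"
  shows "represents (A + B) (\<lambda>z. f z + g z)"
proof -
  from assms obtain U V U' V' where *: "V \<noteq> 0" "A * to_fract V = to_fract U"
      "\<forall>\<^sub>F z in cofinite. f z * poly (cpoly V) z = poly (cpoly U) z"
      "V' \<noteq> 0" "B * to_fract V' = to_fract U'"
      "\<forall>\<^sub>F z in cofinite. g z * poly (cpoly V') z = poly (cpoly U') z"
    unfolding represents_def by blast
  have "(A + B) * to_fract (V * V') = (A * to_fract V) * to_fract V' + (B * to_fract V') * to_fract V"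
    by (simp add: algebra_simps)
  then have "(A + B) * to_fract (V * V') = to_fract (U * V' + U' * V)" unfolding * by simp
  moreover have "\<forall>\<^sub>F z in cofinite. (f z + g z) * poly (cpoly (V * V')) z = poly (cpoly (U * V' + U' * V)) z"
    using *(3,6)
  proof eventually_elim
    case (elim z)
    have "(f z + g z) * poly (cpoly (V * V')) z
        = (f z * poly (cpoly V) z) * poly (cpoly V') z + (g z * poly (cpoly V') z) * poly (cpoly V) z"
      by (simp add: map_poly_of_int_mult algebra_simps)
    then show ?case unfolding elim by (simp add: map_poly_of_int_mult map_poly_of_int_add)
  qed
  moreover have "V * V' \<noteq> 0" using * by simp
  ultimately show ?thesis unfolding represents_def by blast
qed

lemma represents_mult:
  assumes "represents A f" "represents B g"
  shows "represents (A * B) (\<lambda>z. f z * g z)"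
proof -
  from assms obtain U V U' V' where *: "V \<noteq> 0" "A * to_fract V = to_fract U"
      "\<forall>\<^sub>F z in cofinite. f z * poly (cpoly V) z = poly (cpoly U) z"
      "V' \<noteq> 0" "B * to_fract V' = to_fract U'"
      "\<forall>\<^sub>F z in cofinite. g z * poly (cpoly V') z = poly (cpoly U') z"
    unfolding represents_def by blast
  have "(A * B) * to_fract (V * V') = (A * to_fract V) * (B * to_fract V')"
    by (simp add: algebra_simps)
  then have "(A * B) * to_fract (V * V') = to_fract (U * U')" unfolding * by simp
  moreover have "\<forall>\<^sub>F z in cofinite. (f z * g z) * poly (cpoly (V * V')) z = poly (cpoly (U * U')) z"
    using *(3,6)
  proof eventually_elim
    case (elim z)
    have "(f z * g z) * poly (cpoly (V * V')) z = (f z * poly (cpoly V) z) * (g z * poly (cpoly V') z)"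
      by (simp add: map_poly_of_int_mult mult_ac)
    then show ?case unfolding elim by (simp add: map_poly_of_int_mult)
  qed
  moreover have "V * V' \<noteq> 0" using * by simp
  ultimately show ?thesis unfolding represents_def by blast
qed

lemma map_poly_of_int_minus_1: "cpoly (- 1) = - 1"
  by (simp add: poly_eq_iff coeff_map_poly)

lemma represents_minus: "represents A f \<Longrightarrow> represents (- A) (\<lambda>z. - f z)"
  using represents_mult[OF represents_to_fract[of "- 1" "\<lambda>_. - 1"]]
  by (simp add: map_poly_of_int_minus_1)

lemma represents_diff:
  "represents A f \<Longrightarrow> represents B g \<Longrightarrow> represents (A - B) (\<lambda>z. f z - g z)"
  using represents_add[OF _ represents_minus, of A f B g] by simp

lemma represents_inverse:
  assumes "represents A f"
  shows "represents (inverse A) (\<lambda>z. inverse (f z))"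
proof -
  from assms obtain U V where *: "V \<noteq> 0" "A * to_fract V = to_fract U"
      "\<forall>\<^sub>F z in cofinite. f z * poly (cpoly V) z = poly (cpoly U) z"
    unfolding represents_def by blast
  note V = eventually_cofinite_poly_neq_0[OF *(1)]
  show ?thesis
  proof (cases "A = 0")
    \<comment> \<open>Here \<open>f\<close> vanishes off a finite set, and
      \<open>inverse 0 = 0\<close> holds in both fields.\<close>
    case True
    then have "U = 0" using *(2) by simp
    then have "\<forall>\<^sub>F z in cofinite. inverse (f z) * poly (cpoly 1) z = poly (cpoly 0) z"
      using \<open>U = 0\<close> eventually_conj[OF *(3) V] by (auto elim: eventually_mono)
    with True show ?thesis unfolding represents_def
      by (intro exI[of _ 0] exI[of _ 1]) simp
  next
    case False
    then have U: "U \<noteq> 0" using *(1,2) by auto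
    have "\<forall>\<^sub>F z in cofinite. inverse (f z) * poly (cpoly U) z = poly (cpoly V) z"
      using *(3) V eventually_cofinite_poly_neq_0[OF U]
    proof eventually_elim
      case (elim z)
      then have "f z \<noteq> 0" by auto
      then show ?case unfolding elim(1)[symmetric] by simp
    qed
    moreover have "inverse A * to_fract U = to_fract V"
      using False by (simp add: *(2)[symmetric] field_simps)
    ultimately show ?thesis using U unfolding represents_def by blast
  qed
qed

lemma represents_divide:
  "represents A f \<Longrightarrow> represents B g \<Longrightarrow> represents (A / B) (\<lambda>z. f z / g z)"
  using represents_mult[OF _ represents_inverse] by (simp add: divide_inverse)

lemma represents_power: "represents A f \<Longrightarrow> represents (A ^ k) (\<lambda>z. f z ^ k)"
  by (induction k) (auto intro: represents_1 represents_mult)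

lemma represents_power_int: "represents A f \<Longrightarrow> represents (A powi k) (\<lambda>z. f z powi k)"
  unfolding power_int_def by (auto intro: represents_power represents_inverse)

lemma represents_sum:
  "(\<And>i. i \<in> I \<Longrightarrow> represents (A i) (f i)) \<Longrightarrow> represents (\<Sum>i\<in>I. A i) (\<lambda>z. \<Sum>i\<in>I. f i z)"
  by (induction I rule: infinite_finite_induct) (auto intro: represents_0 represents_add)

lemma represents_prod:
  "(\<And>i. i \<in> I \<Longrightarrow> represents (A i) (f i)) \<Longrightarrow> represents (\<Prod>i\<in>I. A i) (\<lambda>z. \<Prod>i\<in>I. f i z)"
  by (induction I rule: infinite_finite_induct) (auto intro: represents_1 represents_mult)

lemma represents_qpoch:
  assumes "represents x f" "represents p g"
  shows "represents (qpoch x p k) (\<lambda>z. qpoch (f z) (g z) k)"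
  unfolding qpoch_def
  by (intro represents_prod represents_diff represents_mult represents_power represents_1 assms)

lemma represents_qint: "represents (qint j) (\<lambda>z. (1 - z powi j) / (1 - z))"
  unfolding qint_def
  by (intro represents_divide represents_diff represents_1 represents_power_int represents_q)

text \<open>Any witnesses \<open>U\<close>, \<open>V\<close> give the same fraction as the reduced
  form, so \<open>N * V = U * M\<close>, and \<open>V\<close> cancels off its finitely many
  zeros.\<close>

lemma represents_numerator:
  assumes "represents A f"
  shows "\<forall>\<^sub>F z in cofinite. poly (cpoly (fst (quot_of_fract A))) z
    = f z * poly (cpoly (snd (quot_of_fract A))) z"
proof -
  from assms obtain U V where *: "V \<noteq> 0" "A * to_fract V = to_fract U"
      "\<forall>\<^sub>F z in cofinite. f z * poly (cpoly V) z = poly (cpoly U) z"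
    unfolding represents_def by blast
  define N M where "N = fst (quot_of_fract A)" and "M = snd (quot_of_fract A)"
  have "M \<noteq> 0" by (simp add: M_def)
  moreover have "A = to_fract N / to_fract M"
    by (simp add: N_def M_def flip: Fract_conv_to_fract)
  ultimately have "A * to_fract M = to_fract N" by simp
  then have "to_fract (N * V) = (A * to_fract V) * to_fract M" by (simp add: mult_ac)
  then have "to_fract (N * V) = to_fract (U * M)"
    unfolding *(2) by simp
  then have "N * V = U * M" by (simp only: to_fract_eq_iff)
  then have "poly (cpoly (N * V)) z = poly (cpoly (U * M)) z" for z by simp
  then have NV: "poly (cpoly N) z * poly (cpoly V) z = poly (cpoly U) z * poly (cpoly M) z" for z
    by (simp add: map_poly_of_int_mult)
  show ?thesis unfolding N_def[symmetric] M_def[symmetric]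
    using *(3) eventually_cofinite_poly_neq_0[OF *(1)]
  proof eventually_elim
    case (elim z)
    have "poly (cpoly V) z * poly (cpoly N) z = poly (cpoly V) z * (f z * poly (cpoly M) z)"
      using NV[of z] elim(1) by (simp add: mult_ac)
    then show ?case using elim(2) by simp
  qed
qed

section \<open>Orders of vanishing and divisibility by the modulus\<close>

lemma eventually_cofinite_imp_at:
  fixes a :: complex
  assumes "\<forall>\<^sub>F z in cofinite. P z"
  shows "\<forall>\<^sub>F z in at a. P z"
proof -
  have "open (- ({z. \<not> P z} - {a}))"
    using assms by (intro open_Compl finite_imp_closed) (simp add: eventually_cofinite)
  then show ?thesis unfolding eventually_at_topological by (rule exI[of _ "- ({z. \<not> P z} - {a})", OF conjI]) auto
qed

text \<open>If the order \<open>o'\<close> of the zero were at most \<open>r\<close>, multiplication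
  by \<open>(z - c) ^ (r - o')\<close> would leave the cofactor \<open>Q\<close> with limit 0,
  against \<open>poly Q c \<noteq> 0\<close>.\<close>

lemma linear_power_dvd_if_tendsto_0:
  fixes P :: "complex poly"
  assumes lim: "((\<lambda>z. poly P z / (z - c) ^ r) \<longlongrightarrow> 0) (at c)"
  shows "[:- c, 1:] ^ Suc r dvd P"
proof (cases "P = 0")
  case False
  define o' where "o' = order c P"
  have "[:- c, 1:] ^ o' dvd P" using order_1[of c P] by (simp add: o'_def)
  then obtain Q where Q: "P = [:- c, 1:] ^ o' * Q" by auto
  have Qc: "poly Q c \<noteq> 0"
  proof
    assume "poly Q c = 0"
    then have "[:- c, 1:] dvd Q" by (simp add: poly_eq_0_iff_dvd)
    then have "[:- c, 1:] ^ Suc o' dvd P" unfolding Q by (metis mult_dvd_mono dvd_refl power_Suc2)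
    then show False using order_2[OF False, of c] by (simp add: o'_def)
  qed
  have "Suc r \<le> o'"
  proof (rule ccontr)
    assume "\<not> Suc r \<le> o'"
    then have r: "r = o' + (r - o')" by simp
    have "((\<lambda>z. poly P z / (z - c) ^ r * (z - c) ^ (r - o')) \<longlongrightarrow> 0 * (c - c) ^ (r - o')) (at c)"
      by (intro tendsto_intros lim)
    moreover have "\<forall>\<^sub>F z in at c. poly P z / (z - c) ^ r * (z - c) ^ (r - o') = poly Q z"
      using eventually_neq_at_within[of c c UNIV]
    proof eventually_elim
      case (elim z)
      have "poly P z = (z - c) ^ o' * poly Q z" by (simp add: Q)
      moreover have "(z - c) ^ r = (z - c) ^ o' * (z - c) ^ (r - o')"
        by (subst r) (simp only: power_add)
      ultimately show ?case using elim by simp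
    qed
    ultimately have "(poly Q \<longlongrightarrow> 0 * (c - c) ^ (r - o')) (at c)"
      by (rule tendsto_cong[THEN iffD1, rotated])
    then have "(poly Q \<longlongrightarrow> 0) (at c)" by (simp only: mult_zero_left)
    moreover have "(poly Q \<longlongrightarrow> poly Q c) (at c)"
      by (intro tendsto_intros)
    ultimately show False using Qc tendsto_unique[of "at c"] by (metis trivial_limit_at)
  qed
  then show ?thesis unfolding Q by (metis dvd_mult2 le_imp_power_dvd)
qed simp

text \<open>Dividing out the power of one linear factor does not change the orders at the other
  points.\<close>

lemma prod_linear_powers_dvd:
  fixes P :: "complex poly"
  assumes "finite S" "\<And>z. z \<in> S \<Longrightarrow> [:- z, 1:] ^ e z dvd P"
  shows "(\<Prod>z\<in>S. [:- z, 1:] ^ e z) dvd P"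
  using assms
proof (induction S arbitrary: P rule: finite_induct)
  case (insert x S)
  show ?case
  proof (cases "P = 0")
    case False
    obtain K where K: "P = [:- x, 1:] ^ e x * K" using insert.prems[of x] by auto
    have "[:- z, 1:] ^ e z dvd K" if "z \<in> S" for z
    proof -
      have "z \<noteq> x" using that insert.hyps by auto
      then have "order z ([:- x, 1:] ^ e x) = 0" by (intro order_0I) simp
      then have "order z P = order z K" using False unfolding K by (subst order_mult) auto
      moreover have "e z \<le> order z P"
        using insert.prems[of z] that False by (simp add: order_divides)
      ultimately show ?thesis by (simp add: order_divides)
    qed
    then have "(\<Prod>z\<in>S. [:- z, 1:] ^ e z) dvd K" by (rule insert.IH)
    then show ?thesis using insert.hyps unfolding K by (simp add: mult_dvd_mono)
  qed simp
qed simp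

text \<open>Multiplication by \<open>q - 1\<close> gives \<open>q ^ n - 1\<close>, whose complex
  factorisation is known.\<close>

lemma cpoly_qint_poly:
  assumes "n > 0"
  shows "cpoly (qint_poly n) = (\<Prod>z\<in>{z. z ^ n = 1} - {1}. [:- z, 1:])"
proof -
  have fin: "finite {z :: complex. z ^ n = 1}"
    using finite_roots_unity[of n] assms by auto
  have "qint_poly n * [:- 1, 1:] = monom 1 n - 1"
  proof -
    have "to_fract (qint_poly n * [:- 1, 1:]) = qint (int n) * (q - 1)"
    proof -
      have "[:- 1, 1:] = [:0, 1:] - (1 :: int poly)" by (simp add: one_pCons)
      then have "to_fract [:- 1, 1:] = q - 1" by (simp only: q_def to_fract_diff to_fract_1)
      then show ?thesis by (simp only: to_fract_mult to_fract_qint_poly)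
    qed
    also have "\<dots> = q ^ n - 1" using q_neq_1 by (simp add: qint_def field_simps)
    also have "\<dots> = to_fract (monom 1 n - 1)"
      by (simp add: q_def monom_altdef to_fract_power)
    finally show ?thesis by (simp only: to_fract_eq_iff)
  qed
  then have "cpoly (qint_poly n) * cpoly [:- 1, 1:] = cpoly (monom 1 n - 1)"
    by (simp flip: map_poly_of_int_mult)
  also have "cpoly [:- 1, 1:] = [:- 1, 1:]" by (simp add: map_poly_pCons)
  also have "cpoly (monom 1 n - 1) = monom 1 n - 1"
    by (simp add: poly_eq_iff coeff_map_poly)
  also have "\<dots> = (\<Prod>z\<in>{z. z ^ n = 1} - {1}. [:- z, 1:]) * [:- 1, 1:]"
    unfolding prod_roots_unity[OF assms, symmetric]
    using prod.remove[OF fin, of 1 "\<lambda>z. [:- z, 1:]"] by (simp add: mult.commute)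
  finally have "cpoly (qint_poly n) * [:- 1, 1:] = (\<Prod>z\<in>{z. z ^ n = 1} - {1}. [:- z, 1:]) * [:- 1, 1:]" .
  then show ?thesis by (subst (asm) mult_right_cancel) simp_all
qed

text \<open>For \<open>n > 1\<close> the primitive roots are among the roots of the q-integer, so
  the modulus is a product of linear factors, cubed at primitive roots and simple elsewhere. It is
  monic, so divisibility over the complex numbers descends to integer coefficients.\<close>

lemma modulus_dvd:
  assumes n: "n > 1"
    and simple: "\<And>z. z ^ n = 1 \<Longrightarrow> z \<noteq> 1 \<Longrightarrow> [:- z, 1:] dvd cpoly N"
    and triple: "\<And>z. z \<in> primitive_roots_unity n \<Longrightarrow> [:- z, 1:] ^ 3 dvd cpoly N"
  shows "qint_poly n * cyclotomic n ^ 2 dvd N"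
proof -
  define R where "R = {z :: complex. z ^ n = 1} - {1}"
  define e where "e z = (if z \<in> primitive_roots_unity n then 3 else 1 :: nat)" for z
  define P where "P = qint_poly n * cyclotomic n ^ 2"
  have fin: "finite R" using finite_roots_unity[of n] n by (auto simp: R_def)
  have sub: "primitive_roots_unity n \<subseteq> R"
  proof
    fix z assume "z \<in> primitive_roots_unity n"
    then have "z ^ n = 1" "z ^ 1 \<noteq> 1" using n unfolding primitive_roots_unity_def by blast+
    then show "z \<in> R" by (simp add: R_def)
  qed
  have "cpoly P = (\<Prod>z\<in>R. [:- z, 1:]) * (\<Prod>z\<in>primitive_roots_unity n. [:- z, 1:]) ^ 2"
    using n by (simp add: P_def map_poly_of_int_mult power2_eq_square cpoly_qint_poly of_int_cyclotomic R_def)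
  also have "(\<Prod>z\<in>primitive_roots_unity n. [:- z, 1:])
      = (\<Prod>z\<in>R. if z \<in> primitive_roots_unity n then [:- z, 1:] else 1)"
    using sub by (simp add: prod.inter_restrict[OF fin, symmetric] Int_absorb1)
  also have "(\<Prod>z\<in>R. [:- z, 1:]) * \<dots> ^ 2 = (\<Prod>z\<in>R. [:- z, 1:] ^ e z)"
    unfolding prod_power_distrib prod.distrib[symmetric]
    by (intro prod.cong refl) (simp add: e_def power3_eq_cube power2_eq_square)
  finally have P: "cpoly P = (\<Prod>z\<in>R. [:- z, 1:] ^ e z)" .
  have "cpoly P dvd cpoly N"
    unfolding P using simple triple by (intro prod_linear_powers_dvd fin) (auto simp: e_def R_def)
  then obtain K where K: "cpoly N = cpoly P * K" by auto
  have "lead_coeff (cpoly P) = 1" unfolding P by (simp add: lead_coeff_prod lead_coeff_power)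
  then have "lead_coeff P = 1" unfolding degree_map_poly_of_int by (simp add: coeff_map_poly)
  from int_quotient_of_monic[OF K this] obtain h where "K = cpoly h" by blast
  then have "N = P * h" using K by (simp add: map_poly_of_int_eq_iff flip: map_poly_of_int_mult)
  then show ?thesis by (simp add: P_def)
qed

text \<open>Off finitely many points the reduced numerator is \<open>f - g\<close> times the reduced
  denominator. The latter is continuous, so the limits of \<open>f - g\<close> carry over to the
  numerator.\<close>

lemma fract_congI:
  assumes n: "n > 1" and rep: "represents A f" "represents B g"
    and simple: "\<And>c. c ^ n = 1 \<Longrightarrow> c \<noteq> 1 \<Longrightarrow> ((\<lambda>z. f z - g z) \<longlongrightarrow> 0) (at c)"
    and triple: "\<And>c. c \<in> primitive_roots_unity n \<Longrightarrow> ((\<lambda>z. (f z - g z) / (z - c)\<^sup>2) \<longlongrightarrow> 0) (at c)"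
  shows "fract_cong A B (qint_poly n * cyclotomic n ^ 2)"
proof -
  define N M where "N = fst (quot_of_fract (A - B))" and "M = snd (quot_of_fract (A - B))"
  have ev: "\<forall>\<^sub>F z in at c. poly (cpoly N) z = (f z - g z) * poly (cpoly M) z" for c
    unfolding N_def M_def
    by (intro eventually_cofinite_imp_at represents_numerator represents_diff rep)
  have dvd: "[:- c, 1:] ^ Suc r dvd cpoly N"
    if "((\<lambda>z. (f z - g z) / (z - c) ^ r) \<longlongrightarrow> 0) (at c)" for c r
  proof (rule linear_power_dvd_if_tendsto_0)
    have "((\<lambda>z. (f z - g z) / (z - c) ^ r * poly (cpoly M) z) \<longlongrightarrow> 0 * poly (cpoly M) c) (at c)"
      by (intro tendsto_intros that)
    moreover have "\<forall>\<^sub>F z in at c. (f z - g z) / (z - c) ^ r * poly (cpoly M) z = poly (cpoly N) z / (z - c) ^ r"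
      using ev[of c] by eventually_elim simp
    ultimately have "((\<lambda>z. poly (cpoly N) z / (z - c) ^ r) \<longlongrightarrow> 0 * poly (cpoly M) c) (at c)"
      by (rule tendsto_cong[THEN iffD1, rotated])
    then show "((\<lambda>z. poly (cpoly N) z / (z - c) ^ r) \<longlongrightarrow> 0) (at c)"
      by (simp only: mult_zero_left)
  qed
  show ?thesis unfolding fract_cong_def N_def[symmetric]
  proof (rule modulus_dvd[OF n])
    show "[:- c, 1:] dvd cpoly N" if "c ^ n = 1" "c \<noteq> 1" for c
      using dvd[of c 0] simple[OF that] by simp
    show "[:- c, 1:] ^ 3 dvd cpoly N" if "c \<in> primitive_roots_unity n" for c
      using dvd[of c 2] triple[OF that] by (simp add: numeral_3_eq_3)
  qed
qed

section \<open>Difference quotients in a parameter\<close>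

text \<open>
  The second component of the argument is the parameter \<open>y\<close>; \<open>h\<close> is a jointly continuous difference
  quotient with respect to it.
\<close>

definition dquot_at :: "complex \<Rightarrow> complex \<Rightarrow> (complex \<times> complex \<Rightarrow> complex) \<Rightarrow> bool" where
  "dquot_at c b g \<longleftrightarrow> isCont g (c, b) \<and> (\<exists>h. isCont h (c, b, b) \<and>
     (\<forall>\<^sub>F w in nhds (c, b, b). g (fst w, fst (snd w)) - g (fst w, snd (snd w))
        = (fst (snd w) - snd (snd w)) * h w))"

lemma dquot_atI:
  assumes "isCont g (c, b)" "isCont h (c, b, b)"
    "\<forall>\<^sub>F w in nhds (c, b, b). g (fst w, fst (snd w)) - g (fst w, snd (snd w)) = (fst (snd w) - snd (snd w)) * h w"
  shows "dquot_at c b g"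
  using assms unfolding dquot_at_def by blast

lemma isCont_slices:
  assumes "isCont g (c, b)"
  shows "isCont (\<lambda>w. g (fst w, fst (snd w))) (c, b, b)" "isCont (\<lambda>w. g (fst w, snd (snd w))) (c, b, b)"
  by (rule isCont_o2[where g = g]; use assms in \<open>auto intro!: continuous_intros\<close>)+

lemma dquot_at_fst:
  assumes "isCont f c"
  shows "dquot_at c b (\<lambda>w. f (fst w))"
proof (rule dquot_atI)
  show "isCont (\<lambda>w. f (fst w)) (c, b)"
    by (rule isCont_o2[where g = f]) (use assms in \<open>auto intro!: continuous_intros\<close>)
qed (auto intro!: always_eventually[of "\<lambda>w. _ = (_ :: complex)"] simp: eventually_True, (rule continuous_const[of _ 0] | simp)+)

lemma dquot_at_snd: "dquot_at c b snd"
  by (rule dquot_atI[of _ _ _ "\<lambda>_. 1"]) (auto intro!: continuous_intros)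

lemma dquot_at_add:
  assumes "dquot_at c b g1" "dquot_at c b g2"
  shows "dquot_at c b (\<lambda>w. g1 w + g2 w)"
proof -
  from assms obtain h1 h2 where *: "isCont g1 (c, b)" "isCont g2 (c, b)" "isCont h1 (c, b, b)" "isCont h2 (c, b, b)"
    and ev: "\<forall>\<^sub>F w in nhds (c, b, b). g1 (fst w, fst (snd w)) - g1 (fst w, snd (snd w)) = (fst (snd w) - snd (snd w)) * h1 w"
     "\<forall>\<^sub>F w in nhds (c, b, b). g2 (fst w, fst (snd w)) - g2 (fst w, snd (snd w)) = (fst (snd w) - snd (snd w)) * h2 w"
    unfolding dquot_at_def by blast
  show ?thesis
  proof (rule dquot_atI[of _ _ _ "\<lambda>w. h1 w + h2 w"])
    show "\<forall>\<^sub>F w in nhds (c, b, b). g1 (fst w, fst (snd w)) + g2 (fst w, fst (snd w))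
        - (g1 (fst w, snd (snd w)) + g2 (fst w, snd (snd w))) = (fst (snd w) - snd (snd w)) * (h1 w + h2 w)"
      using ev by eventually_elim (simp add: algebra_simps)
  qed (intro continuous_intros *)+
qed

lemma dquot_at_mult:
  assumes "dquot_at c b g1" "dquot_at c b g2"
  shows "dquot_at c b (\<lambda>w. g1 w * g2 w)"
proof -
  from assms obtain h1 h2 where *: "isCont g1 (c, b)" "isCont g2 (c, b)" "isCont h1 (c, b, b)" "isCont h2 (c, b, b)"
    and ev: "\<forall>\<^sub>F w in nhds (c, b, b). g1 (fst w, fst (snd w)) - g1 (fst w, snd (snd w)) = (fst (snd w) - snd (snd w)) * h1 w"
     "\<forall>\<^sub>F w in nhds (c, b, b). g2 (fst w, fst (snd w)) - g2 (fst w, snd (snd w)) = (fst (snd w) - snd (snd w)) * h2 w"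
    unfolding dquot_at_def by blast
  show ?thesis
  proof (rule dquot_atI[of _ _ _ "\<lambda>w. h1 w * g2 (fst w, fst (snd w)) + g1 (fst w, snd (snd w)) * h2 w"])
    show "\<forall>\<^sub>F w in nhds (c, b, b). g1 (fst w, fst (snd w)) * g2 (fst w, fst (snd w))
        - g1 (fst w, snd (snd w)) * g2 (fst w, snd (snd w))
        = (fst (snd w) - snd (snd w)) * (h1 w * g2 (fst w, fst (snd w)) + g1 (fst w, snd (snd w)) * h2 w)"
      using ev
    proof eventually_elim
      case (elim w)
      have "g1 (fst w, fst (snd w)) * g2 (fst w, fst (snd w)) - g1 (fst w, snd (snd w)) * g2 (fst w, snd (snd w))
        = (g1 (fst w, fst (snd w)) - g1 (fst w, snd (snd w))) * g2 (fst w, fst (snd w))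
          + g1 (fst w, snd (snd w)) * (g2 (fst w, fst (snd w)) - g2 (fst w, snd (snd w)))"
        by (simp add: algebra_simps)
      then show ?case unfolding elim by (simp add: algebra_simps)
    qed
  qed (intro continuous_intros isCont_slices *)+
qed

lemma eventually_nhds_neq_0:
  fixes f :: "'a :: t2_space \<Rightarrow> 'b :: real_normed_field"
  assumes "isCont f a" "f a \<noteq> 0"
  shows "\<forall>\<^sub>F w in nhds a. f w \<noteq> 0"
  using assms by (intro tendsto_imp_eventually_ne[of f "f a"]) (simp_all add: isCont_def tendsto_at_iff_tendsto_nhds)

lemma dquot_at_inverse:
  assumes "dquot_at c b g" "g (c, b) \<noteq> 0"
  shows "dquot_at c b (\<lambda>w. inverse (g w))"
proof -
  from assms obtain h where *: "isCont g (c, b)" "isCont h (c, b, b)"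
    and ev: "\<forall>\<^sub>F w in nhds (c, b, b). g (fst w, fst (snd w)) - g (fst w, snd (snd w)) = (fst (snd w) - snd (snd w)) * h w"
    unfolding dquot_at_def by blast
  let ?h = "\<lambda>w. - h w * inverse (g (fst w, fst (snd w))) * inverse (g (fst w, snd (snd w)))"
  have nz: "\<forall>\<^sub>F w in nhds (c, b, b). g (fst w, fst (snd w)) \<noteq> 0" "\<forall>\<^sub>F w in nhds (c, b, b). g (fst w, snd (snd w)) \<noteq> 0"
    using isCont_slices[OF *(1)] assms(2) by (auto intro!: eventually_nhds_neq_0)
  show ?thesis
  proof (rule dquot_atI[of _ _ _ ?h])
    show "\<forall>\<^sub>F w in nhds (c, b, b). inverse (g (fst w, fst (snd w))) - inverse (g (fst w, snd (snd w)))
        = (fst (snd w) - snd (snd w)) * ?h w"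
      using ev nz
    proof eventually_elim
      case (elim w)
      have "inverse (g (fst w, fst (snd w))) - inverse (g (fst w, snd (snd w)))
        = - (g (fst w, fst (snd w)) - g (fst w, snd (snd w)))
          * inverse (g (fst w, fst (snd w))) * inverse (g (fst w, snd (snd w)))"
        using elim(2,3) by (simp add: field_simps)
      then show ?case unfolding elim(1) by simp
    qed
  qed (use assms(2) in \<open>auto intro!: continuous_intros isCont_slices *\<close>)
qed

lemma dquot_at_const: "dquot_at c b (\<lambda>_. k)"
  using dquot_at_fst[of c "\<lambda>_. k" b] by simp

lemma dquot_at_diff:
  "dquot_at c b g1 \<Longrightarrow> dquot_at c b g2 \<Longrightarrow> dquot_at c b (\<lambda>w. g1 w - g2 w)"
  using dquot_at_add[OF _ dquot_at_mult[OF dquot_at_const[of c b "- 1"]], of g1 g2] by simp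

lemma dquot_at_divide:
  "dquot_at c b g1 \<Longrightarrow> dquot_at c b g2 \<Longrightarrow> g2 (c, b) \<noteq> 0 \<Longrightarrow> dquot_at c b (\<lambda>w. g1 w / g2 w)"
  using dquot_at_mult[OF _ dquot_at_inverse] by (simp add: divide_inverse)

lemma dquot_at_sum:
  "(\<And>i. i \<in> I \<Longrightarrow> dquot_at c b (g i)) \<Longrightarrow> dquot_at c b (\<lambda>w. \<Sum>i\<in>I. g i w)"
  by (induction I rule: infinite_finite_induct) (auto intro: dquot_at_const dquot_at_add)

lemma dquot_at_prod:
  "(\<And>i. i \<in> I \<Longrightarrow> dquot_at c b (g i)) \<Longrightarrow> dquot_at c b (\<lambda>w. \<Prod>i\<in>I. g i w)"
  by (induction I rule: infinite_finite_induct) (auto intro: dquot_at_const dquot_at_mult)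

text \<open>
  Vanishing along the slice \<open>z = c\<close> forces the difference quotient to be \<open>0\<close> at \<open>(c, b, b)\<close>; this gains one
  order of vanishing over the estimate \<open>b - u z = O(v z)\<close>.
\<close>

lemma dquot_at_limit:
  assumes g: "dquot_at c b g"
    and zero: "\<forall>\<^sub>F y in at b. g (c, y) = 0" "\<forall>\<^sub>F z in at c. g (z, u z) = 0"
    and u: "(u \<longlongrightarrow> b) (at c)" and L: "((\<lambda>z. (b - u z) / v z) \<longlongrightarrow> L) (at c)"
  shows "((\<lambda>z. g (z, b) / v z) \<longlongrightarrow> 0) (at c)"
proof -
  from g obtain h where *: "isCont g (c, b)" "isCont h (c, b, b)"
    and ev: "\<forall>\<^sub>F w in nhds (c, b, b). g (fst w, fst (snd w)) - g (fst w, snd (snd w)) = (fst (snd w) - snd (snd w)) * h w"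
    unfolding dquot_at_def by blast
  have t1: "((\<lambda>y. (c, y)) \<longlongrightarrow> (c, b)) (at b)" by (intro tendsto_intros)
  have t2: "((\<lambda>y. (c, y, b)) \<longlongrightarrow> (c, b, b)) (at b)" by (intro tendsto_intros)
  have t3: "((\<lambda>z. (z, b, u z)) \<longlongrightarrow> (c, b, b)) (at c)" by (intro tendsto_intros u)
  have "((\<lambda>y. g (c, y)) \<longlongrightarrow> g (c, b)) (at b)"
    by (rule isCont_tendsto_compose[OF *(1) t1])
  then have "((\<lambda>y. 0) \<longlongrightarrow> g (c, b)) (at b)"
    using zero(1) by (rule tendsto_cong[THEN iffD1, rotated])
  then have g0: "g (c, b) = 0" by (simp add: tendsto_const_iff)
  have "((\<lambda>y. h (c, y, b)) \<longlongrightarrow> h (c, b, b)) (at b)"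
    by (rule isCont_tendsto_compose[OF *(2) t2])
  \<comment> \<open>Both values of \<open>g\<close> on the slice are 0, and \<open>y - b\<close> can
    be cancelled for \<open>y \<noteq> b\<close>.\<close>
  moreover have "\<forall>\<^sub>F y in at b. h (c, y, b) = 0"
    using eventually_compose_filterlim[OF ev t2] zero(1) eventually_neq_at_within[of b b UNIV]
    by eventually_elim (simp add: g0)
  ultimately have "((\<lambda>y. 0) \<longlongrightarrow> h (c, b, b)) (at b)"
    by (rule tendsto_cong[THEN iffD1, rotated])
  then have h0: "h (c, b, b) = 0" by (simp add: tendsto_const_iff)
  have "((\<lambda>z. h (z, b, u z)) \<longlongrightarrow> 0) (at c)"
    using isCont_tendsto_compose[OF *(2) t3] by (simp add: h0)
  from tendsto_mult[OF L this] have "((\<lambda>z. (b - u z) / v z * h (z, b, u z)) \<longlongrightarrow> 0) (at c)" by simp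
  moreover have "\<forall>\<^sub>F z in at c. (b - u z) / v z * h (z, b, u z) = g (z, b) / v z"
    using eventually_compose_filterlim[OF ev t3] zero(2) by eventually_elim simp
  ultimately show ?thesis by (rule tendsto_cong[THEN iffD1, rotated])
qed

section \<open>The left-hand sum at roots of unity\<close>

text \<open>Since \<open>c ^ (2 * t + 1) = 1\<close>, the numbers \<open>w\<close> and
  \<open>v\<close> below are inverse to each other, so \<open>1 - w = - w * (1 - v)\<close>, and
  likewise for the quadratic factors. Each induction step trades a factor with parameter
  \<open>inverse c\<close> for one with parameter \<open>c\<^sup>2\<close>.\<close>

lemma qpoch_reflect:
  fixes c :: "'a :: field"
  assumes c: "c ^ (2 * t + 1) = 1" and k: "k \<le> t + 1"
  shows "qpoch (inverse c) (c\<^sup>2) k * qpoch (c\<^sup>2) (c\<^sup>2) (t + 1 - k) * c ^ (2 * k)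
      = (- 1) ^ k * c ^ k\<^sup>2 * qpoch (c\<^sup>2) (c\<^sup>2) (t + 1)"
    and "qpoch2 y (inverse c) (c\<^sup>2) k * qpoch2 y (c\<^sup>2) (c\<^sup>2) (t + 1 - k) * (c ^ (2 * k))\<^sup>2
      = (c ^ k\<^sup>2)\<^sup>2 * qpoch2 y (c\<^sup>2) (c\<^sup>2) (t + 1)"
proof -
  have c0: "c \<noteq> 0" using c by auto
  have "qpoch (inverse c) (c\<^sup>2) k * qpoch (c\<^sup>2) (c\<^sup>2) (t + 1 - k) * c ^ (2 * k)
      = (- 1) ^ k * c ^ k\<^sup>2 * qpoch (c\<^sup>2) (c\<^sup>2) (t + 1)
    \<and> qpoch2 y (inverse c) (c\<^sup>2) k * qpoch2 y (c\<^sup>2) (c\<^sup>2) (t + 1 - k) * (c ^ (2 * k))\<^sup>2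
      = (c ^ k\<^sup>2)\<^sup>2 * qpoch2 y (c\<^sup>2) (c\<^sup>2) (t + 1)"
    using k
  proof (induction k)
    case 0
    show ?case by (simp add: qpoch2_def)
  next
    case (Suc k)
    define w where "w = inverse c * (c\<^sup>2) ^ k"
    define v where "v = c\<^sup>2 * (c\<^sup>2) ^ (t - k)"
    have "w * v = inverse c * c\<^sup>2 * (c\<^sup>2) ^ (k + (t - k))"
      by (simp add: w_def v_def power_add mult_ac)
    also have "\<dots> = c * c ^ (2 * t)" using Suc.prems c0 by (simp add: power2_eq_square power_mult)
    finally have wv: "w * v = 1" using c by simp
    have 1: "1 - w = - w * (1 - v)" "1 - y * w + w\<^sup>2 = w\<^sup>2 * (1 - y * v + v\<^sup>2)"
    proof -
      show "1 - w = - w * (1 - v)" using wv by (simp add: algebra_simps)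
      have "w\<^sup>2 * (1 - y * v + v\<^sup>2) = w\<^sup>2 - y * w * (w * v) + (w * v)\<^sup>2"
        by (simp add: algebra_simps power2_eq_square)
      then show "1 - y * w + w\<^sup>2 = w\<^sup>2 * (1 - y * v + v\<^sup>2)" unfolding wv by simp
    qed
    have tk: "t + 1 - k = Suc (t - k)" "t + 1 - Suc k = t - k" using Suc.prems by simp_all
    have cw: "c ^ (Suc k)\<^sup>2 = c ^ k\<^sup>2 * (w * c\<^sup>2)"
    proof -
      have "(Suc k)\<^sup>2 = k\<^sup>2 + (2 * k + 1)" by (simp add: power2_eq_square)
      then have "c ^ (Suc k)\<^sup>2 = c ^ k\<^sup>2 * (c ^ (2 * k) * c)" by (simp add: power_add)
      moreover have "w * c\<^sup>2 = c ^ (2 * k) * c" using c0 by (simp add: w_def power2_eq_square power_mult power_mult_distrib mult_ac)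
      ultimately show ?thesis by simp
    qed
    have ck: "c ^ (2 * Suc k) = c ^ (2 * k) * c\<^sup>2" by (simp add: power2_eq_square mult_ac)
    have IH: "qpoch (inverse c) (c\<^sup>2) k * (qpoch (c\<^sup>2) (c\<^sup>2) (t - k) * (1 - v)) * c ^ (2 * k)
      = (- 1) ^ k * c ^ k\<^sup>2 * qpoch (c\<^sup>2) (c\<^sup>2) (t + 1)"
      "qpoch2 y (inverse c) (c\<^sup>2) k * (qpoch2 y (c\<^sup>2) (c\<^sup>2) (t - k) * (1 - y * v + v\<^sup>2)) * (c ^ (2 * k))\<^sup>2
      = (c ^ k\<^sup>2)\<^sup>2 * qpoch2 y (c\<^sup>2) (c\<^sup>2) (t + 1)"
      using Suc unfolding tk by (simp_all add: qpoch_Suc qpoch2_def v_def)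
    have "qpoch (inverse c) (c\<^sup>2) (Suc k) * qpoch (c\<^sup>2) (c\<^sup>2) (t - k) * (c ^ (2 * k) * c\<^sup>2)
      = (qpoch (inverse c) (c\<^sup>2) k * (qpoch (c\<^sup>2) (c\<^sup>2) (t - k) * (1 - v)) * c ^ (2 * k)) * (- w * c\<^sup>2)"
      unfolding qpoch_Suc w_def[symmetric] 1 by (simp only: mult_ac)
    moreover have "qpoch2 y (inverse c) (c\<^sup>2) (Suc k) = qpoch2 y (inverse c) (c\<^sup>2) k * (1 - y * w + w\<^sup>2)"
      by (simp add: qpoch2_def w_def)
    then have "qpoch2 y (inverse c) (c\<^sup>2) (Suc k) * qpoch2 y (c\<^sup>2) (c\<^sup>2) (t - k) * (c ^ (2 * k) * c\<^sup>2)\<^sup>2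
      = (qpoch2 y (inverse c) (c\<^sup>2) k * (qpoch2 y (c\<^sup>2) (c\<^sup>2) (t - k) * (1 - y * v + v\<^sup>2)) * (c ^ (2 * k))\<^sup>2)
        * (w * c\<^sup>2)\<^sup>2"
      unfolding 1 power_mult_distrib by (simp only: mult_ac)
    ultimately show ?case
      unfolding tk cw ck IH power_mult_distrib[of "c ^ k\<^sup>2"] by simp
  qed
  then show "qpoch (inverse c) (c\<^sup>2) k * qpoch (c\<^sup>2) (c\<^sup>2) (t + 1 - k) * c ^ (2 * k)
      = (- 1) ^ k * c ^ k\<^sup>2 * qpoch (c\<^sup>2) (c\<^sup>2) (t + 1)"
    and "qpoch2 y (inverse c) (c\<^sup>2) k * qpoch2 y (c\<^sup>2) (c\<^sup>2) (t + 1 - k) * (c ^ (2 * k))\<^sup>2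
      = (c ^ k\<^sup>2)\<^sup>2 * qpoch2 y (c\<^sup>2) (c\<^sup>2) (t + 1)"
    by blast+
qed

lemma qpoch2_neq_0_mono:
  fixes x :: "'a :: idom"
  assumes "qpoch2 y x p m \<noteq> 0" and "k \<le> m"
  shows "qpoch2 y x p k \<noteq> 0"
  using assms by (auto simp: qpoch2_def)

text \<open>Once the numerators are reflected into denominators, the weight in
  \<open>\<beta>\<close> is symmetric under replacing \<open>k\<close> by \<open>t + 1 - k\<close>.
  Apart from it, \<open>k\<close> enters only through a difference of two powers of
  \<open>c\<close>.\<close>

lemma lhs_term_at_root_unity:
  fixes c y :: "'a :: field"
  assumes c: "c ^ (2 * t + 1) = 1" and k: "k \<le> t + 1"
    and nz: "qpoch (c\<^sup>2) (c\<^sup>2) (t + 1) \<noteq> 0" "qpoch2 y (c\<^sup>2) (c\<^sup>2) (t + 1) \<noteq> 0"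
  defines "\<beta> \<equiv> \<lambda>k. qpoch (c\<^sup>2) (c\<^sup>2) k ^ 3 * qpoch2 y (c\<^sup>2) (c\<^sup>2) k"
  shows "lhs_term c y k = (c powi (6 * int k ^ 2 - 5 * int k) - c powi (6 * int k ^ 2 - int k - 1))
     / (1 - c) * (\<beta> (t + 1) / (\<beta> k * \<beta> (t + 1 - k)))"
proof -
  have c0: "c \<noteq> 0" using c by auto
  define \<alpha> where "\<alpha> = qpoch (inverse c) (c\<^sup>2) k ^ 3 * qpoch2 y (inverse c) (c\<^sup>2) k"
  have \<beta>0: "\<beta> j \<noteq> 0" if "j \<le> t + 1" for j
    using qpoch_neq_0_mono[OF nz(1) that] qpoch2_neq_0_mono[OF nz(2) that] by (simp add: \<beta>_def)
  have solve: "A = D / C * (E / B)" if "A * B * C = D * E" "B \<noteq> 0" "C \<noteq> 0" for A B C D E :: 'a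
    using that by (simp add: field_simps)
  have "\<alpha> * \<beta> (t + 1 - k) * (c ^ (2 * k)) ^ 5
    = (qpoch (inverse c) (c\<^sup>2) k * qpoch (c\<^sup>2) (c\<^sup>2) (t + 1 - k) * c ^ (2 * k)) ^ 3
      * (qpoch2 y (inverse c) (c\<^sup>2) k * qpoch2 y (c\<^sup>2) (c\<^sup>2) (t + 1 - k) * (c ^ (2 * k))\<^sup>2)"
    by (simp add: \<alpha>_def \<beta>_def power_mult_distrib flip: power_add power_mult)
  also have "\<dots> = (- 1) ^ k * (c ^ k\<^sup>2) ^ 5 * \<beta> (t + 1)"
  proof -
    have "((- 1) ^ k * C * P) ^ 3 * (C\<^sup>2 * Q) = (- 1) ^ k * C ^ 5 * (P ^ 3 * Q)" for C P Q :: 'a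
      by (cases "even k") (simp_all add: power_mult_distrib eval_nat_numeral)
    then show ?thesis unfolding qpoch_reflect[OF c k] \<beta>_def .
  qed
  finally have "\<alpha> = (- 1) ^ k * (c ^ k\<^sup>2) ^ 5 / (c ^ (2 * k)) ^ 5 * (\<beta> (t + 1) / \<beta> (t + 1 - k))"
    by (rule solve) (use c0 \<beta>0 in simp_all)
  then have "lhs_term c y k = (- 1) ^ k * ((1 - c powi (4 * int k - 1)) / (1 - c))
    * ((- 1) ^ k * (c ^ k\<^sup>2) ^ 5 / (c ^ (2 * k)) ^ 5 * (\<beta> (t + 1) / \<beta> (t + 1 - k)) / \<beta> k) * c ^ (k\<^sup>2 + 5 * k)"
    unfolding lhs_term_def \<alpha>_def \<beta>_def by simp
  also have "\<dots> = (1 - c powi (4 * int k - 1)) / (1 - c) * ((c ^ k\<^sup>2) ^ 5 / (c ^ (2 * k)) ^ 5 * c ^ (k\<^sup>2 + 5 * k))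
      * (\<beta> (t + 1) / (\<beta> k * \<beta> (t + 1 - k)))"
    by (simp add: mult_ac flip: power_mult_distrib)
  also have "(c ^ k\<^sup>2) ^ 5 / (c ^ (2 * k)) ^ 5 * c ^ (k\<^sup>2 + 5 * k) = c powi (6 * int k ^ 2 - 5 * int k)"
  proof -
    have "c powi (6 * int k ^ 2 - 5 * int k) = c powi int (6 * k\<^sup>2) / c powi int (5 * k)"
      using c0 by (subst power_int_diff[symmetric]) simp_all
    also have "\<dots> = c ^ (6 * k\<^sup>2) / c ^ (5 * k)" by (simp only: power_int_of_nat)
    also have "\<dots> = (c ^ k\<^sup>2) ^ 5 / (c ^ (2 * k)) ^ 5 * c ^ (k\<^sup>2 + 5 * k)"
      using c0 by (simp add: divide_simps add.commute flip: power_mult power_add)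
    finally show ?thesis ..
  qed
  also have "(1 - c powi (4 * int k - 1)) / (1 - c) * c powi (6 * int k ^ 2 - 5 * int k)
     = (c powi (6 * int k ^ 2 - 5 * int k) - c powi (6 * int k ^ 2 - int k - 1)) / (1 - c)"
  proof -
    have "c powi (4 * int k - 1) * c powi (6 * int k ^ 2 - 5 * int k) = c powi (6 * int k ^ 2 - int k - 1)"
      using c0 by (subst power_int_add[symmetric]) (simp_all add: algebra_simps)
    then show ?thesis by (simp add: left_diff_distrib)
  qed
  finally show ?thesis .
qed

text \<open>Replacing \<open>k\<close> by \<open>t + 1 - k\<close> interchanges the two powers of
  \<open>c\<close>, because the exponents then agree modulo \<open>2 * t + 1\<close>. The sum
  therefore equals its negative.\<close>

lemma sum_lhs_term_at_root_unity:
  fixes c y :: "'a :: field_char_0"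
  assumes c: "c ^ (2 * t + 1) = 1"
    and nz: "qpoch (c\<^sup>2) (c\<^sup>2) (t + 1) \<noteq> 0" "qpoch2 y (c\<^sup>2) (c\<^sup>2) (t + 1) \<noteq> 0"
  shows "(\<Sum>k\<le>t + 1. lhs_term c y k) = 0"
proof -
  have c0: "c \<noteq> 0" using c by auto
  have pw: "c powi (6 * (int t + 1 - k) ^ 2 - 5 * (int t + 1 - k)) = c powi (6 * k ^ 2 - k - 1)" for k :: int
  proof -
    have "6 * (int t + 1 - k) ^ 2 - 5 * (int t + 1 - k)
        = (6 * k ^ 2 - k - 1) + int (2 * t + 1) * (3 * (int t + 1) - 1 - 6 * k)"
      by (simp add: algebra_simps power2_eq_square)
    moreover have "c powi (int (2 * t + 1) * j) = 1" for j
      unfolding power_int_mult power_int_of_nat c by simp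
    ultimately show ?thesis by (simp only: power_int_add[OF disjI1[OF c0]] mult_1_right)
  qed
  have anti: "lhs_term c y (t + 1 - k) = - lhs_term c y k" if k: "k \<le> t + 1" for k
  proof -
    have j: "int (t + 1 - k) = int t + 1 - int k" "t + 1 - (t + 1 - k) = k" using k by auto
    have pw2: "c powi (6 * (int t + 1 - int k) ^ 2 - (int t + 1 - int k) - 1) = c powi (6 * int k ^ 2 - 5 * int k)"
      using pw[of "int t + 1 - int k"] by simp
    show ?thesis
      unfolding lhs_term_at_root_unity[OF c k nz] lhs_term_at_root_unity[OF c diff_le_self nz] j pw pw2
      by (simp add: mult.commute flip: minus_divide_left minus_mult_left)
         (simp add: field_simps diff_divide_distrib)
  qed
  define S where "S = (\<Sum>k\<le>t + 1. lhs_term c y k)"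
  have "S = (\<Sum>k\<le>t + 1. lhs_term c y (t + 1 - k))"
    unfolding S_def
    by (rule sum.reindex_bij_witness[of _ "\<lambda>k. t + 1 - k" "\<lambda>k. t + 1 - k"]) auto
  also have "\<dots> = - S" unfolding S_def sum_negf[symmetric] by (intro sum.cong refl anti) simp
  finally have "S = 0" by simp
  then show ?thesis by (simp add: S_def)
qed

lemma qpoch_eq_0I: "x * p ^ j = 1 \<Longrightarrow> j < k \<Longrightarrow> qpoch x p k = 0"
  by (auto simp: qpoch_def intro!: prod_zero)

text \<open>The factor of index \<open>t + 1\<close> in the numerator is
  \<open>1 - c ^ (2 * t + 1)\<close>. Terms beyond \<open>t + 1\<close> thus drop out, which lets
  both choices of \<open>m\<close> be treated together.\<close>

lemma lhs_term_tail:
  fixes c y :: "'a :: field"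
  assumes "c ^ (2 * t + 1) = 1" "t + 1 < k"
  shows "lhs_term c y k = 0"
proof -
  have "c \<noteq> 0" using assms by auto
  then have "inverse c * (c\<^sup>2) ^ (t + 1) = c ^ (2 * t + 1)"
    by (simp add: power_mult power2_eq_square power_mult_distrib)
  then have "qpoch (inverse c) (c\<^sup>2) k = 0" using assms by (intro qpoch_eq_0I[of _ _ "t + 1"]) simp_all
  then show ?thesis by (simp add: lhs_term_def)
qed

text \<open>On the curve used for Watson's transformation the same truncation comes from the
  terminating parameter \<open>inverse z / x\<close>.\<close>

lemma lhs_term_tail_watson:
  fixes z :: "'a :: field"
  assumes "z \<noteq> 0" "t + 1 < k"
  shows "lhs_term z (z ^ (2 * t + 1) + 1 / z ^ (2 * t + 1)) k = 0"
proof -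
  define x where "x = z ^ (2 * t + 1)"
  have x: "x \<noteq> 0" using assms by (simp add: x_def)
  have "inverse z / x * (z\<^sup>2) ^ (t + 1) = 1"
    using assms(1) by (simp add: x_def power_mult power2_eq_square power_mult_distrib)
  then have "qpoch (inverse z / x) (z\<^sup>2) k = 0" using assms by (intro qpoch_eq_0I[of _ _ "t + 1"]) simp_all
  then show ?thesis
    unfolding x_def[symmetric] lhs_term_def qpoch_mult_qpoch_eq_qpoch2[OF x, symmetric] by simp
qed

text \<open>The order \<open>2 * t + 1\<close> is odd, so \<open>c\<^sup>2\<close> has the same
  order, and the first \<open>2 * t\<close> factors do not vanish.\<close>

lemma primitive_root_unity_facts:
  assumes c: "c \<in> primitive_roots_unity (2 * t + 1)" and t: "t > 0"
  shows "c ^ (2 * t + 1) = 1" "c \<noteq> 0" "c \<noteq> 1"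
    and "\<And>k. k \<le> 2 * t \<Longrightarrow> qpoch (c\<^sup>2) (c\<^sup>2) k \<noteq> 0"
proof -
  show c1: "c ^ (2 * t + 1) = 1" using c by (simp add: primitive_roots_unity_def)
  then show "c \<noteq> 0" by auto
  have least: "c ^ i \<noteq> 1" if "0 < i" "i < 2 * t + 1" for i
    using c that by (simp add: primitive_roots_unity_def)
  from this[of 1] show "c \<noteq> 1" using t by simp
  have "c\<^sup>2 * (c\<^sup>2) ^ j \<noteq> 1" if j: "j < 2 * t" for j
  proof
    assume "c\<^sup>2 * (c\<^sup>2) ^ j = 1"
    then have *: "c ^ (2 * Suc j) = 1" by (simp only: power_mult power_Suc)
    show False
    proof (cases "2 * Suc j < 2 * t + 1")
      case True
      then show False using * least[of "2 * Suc j"] by simp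
    next
      case False
      then have "2 * Suc j = (2 * t + 1) + (2 * Suc j - (2 * t + 1))" by simp
      then have "c ^ (2 * Suc j) = c ^ (2 * t + 1) * c ^ (2 * Suc j - (2 * t + 1))"
        by (metis power_add)
      then have "c ^ (2 * Suc j - (2 * t + 1)) = 1" by (simp only: * c1 mult_1_left)
      moreover have "0 < 2 * Suc j - (2 * t + 1)" "2 * Suc j - (2 * t + 1) < 2 * t + 1"
        using False j by presburger+
      ultimately show False using least by blast
    qed
  qed
  then show "qpoch (c\<^sup>2) (c\<^sup>2) k \<noteq> 0" if "k \<le> 2 * t" for k
    using that by (auto simp: qpoch_def)
qed

section \<open>Vanishing to third order at primitive roots\<close>

lemma isCont_qpoch:
  fixes f g :: "complex \<Rightarrow> complex"
  assumes "isCont f c" "isCont g c"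
  shows "isCont (\<lambda>z. qpoch (f z) (g z) k) c"
  unfolding qpoch_def by (intro continuous_intros assms)

lemma dquot_at_qpoch2:
  assumes "isCont f c" "isCont g c"
  shows "dquot_at c b (\<lambda>w. qpoch2 (snd w) (f (fst w)) (g (fst w)) k)"
proof -
  have "isCont (\<lambda>z. f z * g z ^ j) c" "isCont (\<lambda>z. 1 + (f z * g z ^ j)\<^sup>2) c" for j
    by (intro continuous_intros assms)+
  note * = this[THEN dquot_at_fst, of b]
  have "qpoch2 (snd w) (f (fst w)) (g (fst w)) k
     = (\<Prod>j<k. (1 + (f (fst w) * g (fst w) ^ j)\<^sup>2) - snd w * (f (fst w) * g (fst w) ^ j))" for w
    by (simp add: qpoch2_def algebra_simps)
  then show ?thesis
    by (simp only:) (intro dquot_at_prod dquot_at_diff dquot_at_mult dquot_at_snd *)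
qed

text \<open>At \<open>y = 2\<close> the deformed factor is a square by \<open>qpoch2_2\<close>, so
  the hypothesis on \<open>qpoch\<close> also keeps the denominator that depends on \<open>y\<close>
  away from 0.\<close>

lemma dquot_at_lhs_term:
  assumes c: "c \<noteq> 0" "c \<noteq> 1" "qpoch (c\<^sup>2) (c\<^sup>2) k \<noteq> 0"
  shows "dquot_at c 2 (\<lambda>w. lhs_term (fst w) (snd w) k)"
proof -
  define a where "a z = (- 1) ^ k * ((1 - z powi (4 * int k - 1)) / (1 - z))
     * (qpoch (inverse z) (z\<^sup>2) k ^ 3 / qpoch (z\<^sup>2) (z\<^sup>2) k ^ 3) * z ^ (k\<^sup>2 + 5 * k)" for z :: complex
  have "isCont a c"
    unfolding a_def using c by (intro continuous_intros isCont_qpoch) auto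
  then have "dquot_at c 2 (\<lambda>w. a (fst w) * (qpoch2 (snd w) (inverse (fst w)) ((fst w)\<^sup>2) k
      / qpoch2 (snd w) ((fst w)\<^sup>2) ((fst w)\<^sup>2) k))"
    using c by (intro dquot_at_mult dquot_at_divide dquot_at_fst
        dquot_at_qpoch2[where f = "\<lambda>z. z\<^sup>2" and g = "\<lambda>z. z\<^sup>2"]
        dquot_at_qpoch2[where f = inverse and g = "\<lambda>z. z\<^sup>2"])
      (auto intro!: continuous_intros simp: qpoch2_2)
  then show ?thesis by (simp add: a_def lhs_term_def mult_ac)
qed

lemma dquot_at_rhs_sum:
  assumes c: "c \<noteq> 0" "qpoch (c\<^sup>2) (c\<^sup>2) N \<noteq> 0"
  shows "dquot_at c b (\<lambda>w. rhs_sum (fst w) (snd w) N)"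
proof -
  define a where "a k z = qpoch (z ^ 3) (z\<^sup>2) k / qpoch (z\<^sup>2) (z\<^sup>2) k ^ 3 * z ^ (3 * k)" for k and z :: complex
  have "isCont (a k) c" if "k \<le> N" for k
    unfolding a_def using c qpoch_neq_0_mono[OF c(2) that] by (intro continuous_intros isCont_qpoch) auto
  then have "dquot_at c b (\<lambda>w. \<Sum>k\<le>N. qpoch2 (snd w) (inverse (fst w)) ((fst w)\<^sup>2) k * a k (fst w))"
    using c by (intro dquot_at_sum dquot_at_mult dquot_at_fst
        dquot_at_qpoch2[where f = inverse and g = "\<lambda>z. z\<^sup>2"]) (auto intro!: continuous_intros)
  then show ?thesis by (simp add: a_def rhs_sum_def mult_ac)
qed

lemma finite_roots_unity_le: "finite {z :: complex. \<exists>i. 0 < i \<and> i \<le> N \<and> z ^ i = 1}"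
proof -
  have "finite {z :: complex. z ^ i = 1}" if "i > 0" for i
    using finite_roots_unity[of i] that by auto
  then have "finite (\<Union>i\<in>{0<..N}. {z :: complex. z ^ i = 1})" by auto
  then show ?thesis by (rule rev_finite_subset) auto
qed

lemma eventually_at_no_root_unity:
  fixes c :: complex
  shows "\<forall>\<^sub>F z in at c. z \<noteq> 0 \<and> (\<forall>i. 0 < i \<longrightarrow> i \<le> N \<longrightarrow> z ^ i \<noteq> 1)"
proof -
  have "{z. \<not> (z \<noteq> 0 \<and> (\<forall>i. 0 < i \<longrightarrow> i \<le> N \<longrightarrow> z ^ i \<noteq> 1))}
      = insert 0 {z :: complex. \<exists>i. 0 < i \<and> i \<le> N \<and> z ^ i = 1}" by auto
  then show ?thesis
    by (intro eventually_cofinite_imp_at) (simp only: eventually_cofinite finite_insert finite_roots_unity_le)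
qed

lemma tendsto_power_minus_1_quotient:
  fixes c :: complex
  assumes "c ^ n = 1"
  shows "((\<lambda>z. (z ^ n - 1) / (z - c)) \<longlongrightarrow> of_nat n * c ^ (n - 1)) (at c)"
proof -
  have "((\<lambda>z. z ^ n) has_field_derivative of_nat n * c ^ (n - 1)) (at c)"
    by (auto intro!: derivative_eq_intros)
  then show ?thesis by (simp add: has_field_derivative_iff assms)
qed

text \<open>An application of \<open>dquot_at_limit\<close> at \<open>b = 2\<close>: the difference
  of the two sides vanishes on the slice \<open>z = c\<close> by antisymmetry, and on the curve
  \<open>y = z ^ n + 1 / z ^ n\<close> by Watson's transformation.\<close>

lemma primitive_root_limit:
  fixes t m :: nat
  assumes c: "c \<in> primitive_roots_unity (2 * t + 1)" and t: "t > 0" and m: "t + 1 \<le> m" "m \<le> 2 * t"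
  shows "((\<lambda>z. ((\<Sum>k\<le>m. lhs_term z 2 k)
     - (1 - z ^ (2 * t + 1)) / (1 - z) * (- z) ^ (t\<^sup>2 - 1) * rhs_sum z 2 (t + 1)) / (z - c)\<^sup>2) \<longlongrightarrow> 0) (at c)"
proof -
  let ?n = "2 * t + 1"
  note facts = primitive_root_unity_facts[OF c t]
  define r where "r z = (1 - z ^ ?n) / (1 - z) * (- z) ^ (t\<^sup>2 - 1)" for z :: complex
  define g where "g w = (\<Sum>k\<le>m. lhs_term (fst w) (snd w) k) - r (fst w) * rhs_sum (fst w) (snd w) (t + 1)"
    for w :: "complex \<times> complex"
  have split: "(\<Sum>k\<le>m. f k) = (\<Sum>k\<le>t + 1. f k)" if "\<And>k. t + 1 < k \<Longrightarrow> f k = 0" for f :: "nat \<Rightarrow> complex"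
    using m(1) that by (intro sum.mono_neutral_right) auto
  have "((\<lambda>z. g (z, 2) / (z - c)\<^sup>2) \<longlongrightarrow> 0) (at c)"
  proof (rule dquot_at_limit[where u = "\<lambda>z. z ^ ?n + 1 / z ^ ?n"])
    show "dquot_at c 2 g"
    proof -
      have "isCont r c" unfolding r_def using facts by (intro continuous_intros) auto
      then show ?thesis
        unfolding g_def using m facts
        by (intro dquot_at_diff dquot_at_sum dquot_at_mult dquot_at_fst dquot_at_lhs_term dquot_at_rhs_sum) auto
    qed
  next
    \<comment> \<open>Only \<open>y\<close> near 2 matters, and there the denominators stay nonzero
      by continuity.\<close>
    have "qpoch2 2 (c\<^sup>2) (c\<^sup>2) (t + 1) \<noteq> 0" using facts(4)[of "t + 1"] t by (simp add: qpoch2_2)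
    moreover have "isCont (\<lambda>y. qpoch2 y (c\<^sup>2) (c\<^sup>2) (t + 1)) 2"
      unfolding qpoch2_def by (intro continuous_intros)
    ultimately have "\<forall>\<^sub>F y in nhds 2. qpoch2 y (c\<^sup>2) (c\<^sup>2) (t + 1) \<noteq> 0"
      by (intro eventually_nhds_neq_0)
    then have "\<forall>\<^sub>F y in at 2. qpoch2 y (c\<^sup>2) (c\<^sup>2) (t + 1) \<noteq> 0"
      by (simp add: eventually_at_filter eventually_mono)
    then show "\<forall>\<^sub>F y in at 2. g (c, y) = 0"
    proof eventually_elim
      case (elim y)
      have "(\<Sum>k\<le>m. lhs_term c y k) = (\<Sum>k\<le>t + 1. lhs_term c y k)"
        by (rule split) (rule lhs_term_tail[OF facts(1)])
      also have "\<dots> = 0"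
        using facts(4)[of "t + 1"] t elim by (intro sum_lhs_term_at_root_unity facts(1)) auto
      moreover have "r c = 0" using facts(1) by (simp add: r_def)
      ultimately show ?case by (simp add: g_def)
    qed
  next
    show "\<forall>\<^sub>F z in at c. g (z, z ^ ?n + 1 / z ^ ?n) = 0"
      using eventually_at_no_root_unity[of "4 * t + 3" c]
    proof eventually_elim
      case (elim z)
      have "(\<Sum>k\<le>m. lhs_term z (z ^ ?n + 1 / z ^ ?n) k) = (\<Sum>k\<le>t + 1. lhs_term z (z ^ ?n + 1 / z ^ ?n) k)"
        using elim by (intro split lhs_term_tail_watson) auto
      also have "\<dots> = r z * rhs_sum z (z ^ ?n + 1 / z ^ ?n) (t + 1)"
        unfolding r_def using elim by (intro watson_specialised t) auto
      finally show ?case by (simp add: g_def)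
    qed
  next
    have "((\<lambda>z. z ^ ?n + 1 / z ^ ?n) \<longlongrightarrow> c ^ ?n + 1 / c ^ ?n) (at c)"
      using facts(2) by (intro tendsto_intros) auto
    then show "((\<lambda>z. z ^ ?n + 1 / z ^ ?n) \<longlongrightarrow> 2) (at c)" unfolding facts(1) by simp
  next
    \<comment> \<open>With \<open>x = z ^ n\<close> one has
      \<open>2 - (x + 1 / x) = - ((x - 1)\<^sup>2) / x\<close>, so the distance to 2 is of second
      order in \<open>z - c\<close>.\<close>
    have "((\<lambda>z. - ((z ^ ?n - 1) / (z - c))\<^sup>2 / z ^ ?n) \<longlongrightarrow> - (of_nat ?n * c ^ (?n - 1))\<^sup>2 / c ^ ?n) (at c)"
      using facts(2) by (intro tendsto_intros tendsto_power_minus_1_quotient facts(1)) auto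
    moreover have "\<forall>\<^sub>F z in at c. - ((z ^ ?n - 1) / (z - c))\<^sup>2 / z ^ ?n = (2 - (z ^ ?n + 1 / z ^ ?n)) / (z - c)\<^sup>2"
      using eventually_at_no_root_unity[of 0 c]
    proof eventually_elim
      case (elim z)
      define x where "x = z ^ ?n"
      have "x \<noteq> 0" using elim by (simp add: x_def)
      then have "2 - (x + 1 / x) = - ((x - 1)\<^sup>2) / x"
        by (simp add: field_simps power2_eq_square)
      then show ?case unfolding x_def[symmetric] by (simp add: power_divide)
    qed
    ultimately show "((\<lambda>z. (2 - (z ^ ?n + 1 / z ^ ?n)) / (z - c)\<^sup>2) \<longlongrightarrow> - (of_nat ?n * c ^ (?n - 1))\<^sup>2 / c ^ ?n) (at c)"
      by (rule tendsto_cong[THEN iffD1, rotated])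
  qed
  then show ?thesis by (simp add: g_def r_def)
qed

section \<open>Vanishing at the remaining roots\<close>

lemma sum_blocks:
  fixes f :: "nat \<Rightarrow> 'a :: comm_monoid_add"
  shows "(\<Sum>k<l * d + r. f k) = (\<Sum>j<l. \<Sum>i<d. f (j * d + i)) + (\<Sum>i<r. f (l * d + i))"
proof -
  have *: "(\<Sum>k<a + r. f k) = (\<Sum>k<a. f k) + (\<Sum>i<r. f (a + i))" for a r
    by (induction r) (simp_all add: add_ac)
  have "(\<Sum>k<l * d. f k) = (\<Sum>j<l. \<Sum>i<d. f (j * d + i))"
    by (induction l) (simp_all add: *[of _ d] add.commute[of d])
  then show ?thesis by (simp only: *)
qed

text \<open>At \<open>y = 2\<close> all five factors coincide. The terms at roots of smaller order
  are governed by this one quotient, whose numerator and denominator can both vanish there.\<close>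

definition qratio :: "'a :: field \<Rightarrow> nat \<Rightarrow> 'a" where
  "qratio z k = qpoch (inverse z) (z\<^sup>2) k / qpoch (z\<^sup>2) (z\<^sup>2) k"

lemma lhs_term_2:
  "lhs_term z 2 k = (- 1) ^ k * ((1 - z powi (4 * int k - 1)) / (1 - z)) * qratio z k ^ 5 * z ^ (k\<^sup>2 + 5 * k)"
proof -
  have "A ^ 3 * A\<^sup>2 / (B ^ 3 * B\<^sup>2) = (A / B) ^ 5" for A B :: 'a
    by (simp add: power_divide flip: power_add)
  then show ?thesis by (simp only: lhs_term_def qpoch2_2 qratio_def)
qed

lemma qratio_add:
  "qratio z (m + k) = qratio z m * (qpoch (inverse z * (z\<^sup>2) ^ m) (z\<^sup>2) k / qpoch (z\<^sup>2 * (z\<^sup>2) ^ m) (z\<^sup>2) k)"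
  by (simp add: qratio_def qpoch_add)

text \<open>
  Each block of \<open>2 t + 1\<close> factors contributes exactly one vanishing factor to the numerator and one to
  the denominator; their quotient has a limit.
\<close>

lemma qratio_block_converges:
  fixes c :: complex
  assumes c: "c \<in> primitive_roots_unity (2 * t + 1)" and t: "t > 0"
  shows "\<exists>L. ((\<lambda>z. qratio z (l * (2 * t + 1))) \<longlongrightarrow> L) (at c)"
proof (induction l)
  case 0
  show ?case by (auto simp: qratio_def)
next
  case (Suc l)
  note facts = primitive_root_unity_facts[OF c t]
  let ?d = "2 * t + 1"
  let ?x = "\<lambda>z :: complex. inverse z * (z\<^sup>2) ^ (l * ?d)"
  let ?y = "\<lambda>z :: complex. z\<^sup>2 * (z\<^sup>2) ^ (l * ?d)"
  \<comment> \<open>Exponents in the vanishing factors: index \<open>t + 1\<close> of the numerator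
    block and the last index \<open>2 * t\<close> of the denominator block. \<open>G\<close>
    collects the other factors and is continuous at \<open>c\<close>.\<close>
  let ?a = "(2 * l + 1) * ?d" and ?b = "(2 * l + 2) * ?d"
  define G where "G z = qpoch (?x z) (z\<^sup>2) (t + 1) * qpoch (?x z * (z\<^sup>2) ^ (t + 2)) (z\<^sup>2) (t - 1)
    / qpoch (?y z) (z\<^sup>2) (2 * t)" for z
  have pw: "c ^ (j * ?d) = 1" for j
    by (subst mult.commute) (simp only: power_mult facts(1) power_one)
  have c2: "(c\<^sup>2) ^ (l * ?d) = 1"
    using pw[of "2 * l"] by (simp only: power_mult[symmetric] mult.assoc)
  have "isCont G c"
    unfolding G_def using facts(2) facts(4)[of "2 * t"] c2
    by (intro continuous_intros isCont_qpoch) (simp_all only: mult_1_right order_refl not_False_eq_True)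
  then have G: "(G \<longlongrightarrow> G c) (at c)" by (simp add: isCont_def)
  \<comment> \<open>Both zeros are simple, so the quotient tends to the quotient of the
    derivatives.\<close>
  have "((\<lambda>z. ((z ^ ?a - 1) / (z - c)) / ((z ^ ?b - 1) / (z - c)))
      \<longlongrightarrow> (of_nat ?a * c ^ (?a - 1)) / (of_nat ?b * c ^ (?b - 1))) (at c)"
  proof (intro tendsto_divide tendsto_power_minus_1_quotient pw)
    have "of_nat b * c ^ (b - 1) \<noteq> 0" if "b \<noteq> 0" for b using that facts(2) by simp
    from this[of ?b] show "of_nat ?b * c ^ (?b - 1) \<noteq> 0" by simp
  qed
  moreover have "\<forall>\<^sub>F z in at c. ((z ^ ?a - 1) / (z - c)) / ((z ^ ?b - 1) / (z - c)) = (1 - z ^ ?a) / (1 - z ^ ?b)"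
    using eventually_neq_at_within[of c c UNIV]
  proof eventually_elim
    case (elim z)
    have cancel: "(A - 1) / D / ((B - 1) / D) = (1 - A) / (1 - B)" if "D \<noteq> 0" for A B D :: complex
      using that by (metis divide_divide_eq_right minus_diff_eq minus_divide_divide
          nonzero_mult_div_cancel_right times_divide_eq_left)
    show ?case by (rule cancel) (use elim in simp)
  qed
  ultimately have R: "((\<lambda>z. (1 - z ^ ?a) / (1 - z ^ ?b))
      \<longlongrightarrow> (of_nat ?a * c ^ (?a - 1)) / (of_nat ?b * c ^ (?b - 1))) (at c)"
    by (rule tendsto_cong[THEN iffD1, rotated])
  from Suc.IH obtain L where "((\<lambda>z. qratio z (l * ?d)) \<longlongrightarrow> L) (at c)" by blast
  note lim = tendsto_mult[OF this tendsto_mult[OF G R]]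
  have ev: "\<forall>\<^sub>F z in at c. qratio z (l * ?d) * (G z * ((1 - z ^ ?a) / (1 - z ^ ?b))) = qratio z (Suc l * ?d)"
    using eventually_at_no_root_unity[of 0 c]
  proof eventually_elim
    case (elim z)
    then have z: "z \<noteq> 0" by simp
    have xa: "?x z * (z\<^sup>2) ^ (t + 1) = z ^ ?a"
    proof -
      have "z * (?x z * (z\<^sup>2) ^ (t + 1)) = z ^ (2 * (l * ?d) + 2 * (t + 1))"
        using z by (simp only: power_add power_mult) simp
      also have "2 * (l * ?d) + 2 * (t + 1) = Suc ?a" by (simp add: algebra_simps)
      finally show ?thesis using z by (simp only: power_Suc mult_left_cancel not_False_eq_True)
    qed
    have yb: "?y z * (z\<^sup>2) ^ (2 * t) = z ^ ?b"
    proof -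
      have "?y z * (z\<^sup>2) ^ (2 * t) = z ^ (2 + 2 * (l * ?d) + 2 * (2 * t))"
        by (simp only: power_add power_mult)
      also have "2 + 2 * (l * ?d) + 2 * (2 * t) = ?b" by (simp add: algebra_simps)
      finally show ?thesis .
    qed
    have split: "qpoch X p (t + 1 + 1 + (t - 1)) = qpoch X p (t + 1) * (1 - X * p ^ (t + 1))
        * qpoch (X * p ^ (t + 2)) p (t - 1)" for X p :: complex
      unfolding qpoch_add[of X p "t + 1 + 1"]
      by (simp only: Suc_eq_plus1[symmetric] add_2_eq_Suc' qpoch_Suc)
    have d: "?d = (t + 1 + 1) + (t - 1)" using t by simp
    have "qpoch (?x z) (z\<^sup>2) ?d = qpoch (?x z) (z\<^sup>2) (t + 1) * (1 - z ^ ?a) * qpoch (?x z * (z\<^sup>2) ^ (t + 2)) (z\<^sup>2) (t - 1)"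
      using split[of "?x z" "z\<^sup>2"] unfolding xa d[symmetric] .
    moreover have "qpoch (?y z) (z\<^sup>2) ?d = qpoch (?y z) (z\<^sup>2) (2 * t) * (1 - z ^ ?b)"
      by (simp only: Suc_eq_plus1[symmetric] qpoch_Suc yb[unfolded Suc_eq_plus1[symmetric]])
    ultimately have "qpoch (?x z) (z\<^sup>2) ?d / qpoch (?y z) (z\<^sup>2) ?d = G z * ((1 - z ^ ?a) / (1 - z ^ ?b))"
      by (simp only: G_def times_divide_times_eq) (simp only: mult_ac)
    moreover have "Suc l * ?d = l * ?d + ?d" by simp
    ultimately show ?case by (simp only: qratio_add)
  qed
  show ?case using tendsto_cong[OF ev] lim by blast
qed

text \<open>At \<open>c\<close> the factors after \<open>l\<close> whole blocks repeat those of the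
  first block, so \<open>L\<close> depends on \<open>l\<close> only. The bound on \<open>i\<close>
  keeps the denominator nonzero.\<close>

lemma qratio_limit:
  fixes c :: complex
  assumes c: "c \<in> primitive_roots_unity (2 * t + 1)" and t: "t > 0"
  obtains L where "\<And>i. i \<le> 2 * t \<Longrightarrow> ((\<lambda>z. qratio z (l * (2 * t + 1) + i)) \<longlongrightarrow> L * qratio c i) (at c)"
proof -
  note facts = primitive_root_unity_facts[OF c t]
  let ?d = "2 * t + 1"
  obtain L where L: "((\<lambda>z. qratio z (l * ?d)) \<longlongrightarrow> L) (at c)"
    using qratio_block_converges[OF c t] by blast
  have "(c ^ ?d) ^ (l * 2) = 1" unfolding facts(1) by simp
  then have c2: "(c\<^sup>2) ^ (l * ?d) = 1" by (simp only: power_mult[symmetric]) (simp only: mult_ac)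
  have "((\<lambda>z. qratio z (l * ?d + i)) \<longlongrightarrow> L * qratio c i) (at c)" if i: "i \<le> 2 * t" for i
  proof -
    define G where "G z = qpoch (inverse z * (z\<^sup>2) ^ (l * ?d)) (z\<^sup>2) i / qpoch (z\<^sup>2 * (z\<^sup>2) ^ (l * ?d)) (z\<^sup>2) i"
      for z :: complex
    have "isCont G c"
      unfolding G_def using facts(2) facts(4)[OF i] c2
      by (intro continuous_intros isCont_qpoch) (simp_all only: mult_1_right order_refl not_False_eq_True)
    moreover have "G c = qratio c i" unfolding G_def qratio_def c2 by simp
    ultimately have "(G \<longlongrightarrow> qratio c i) (at c)" by (simp add: isCont_def)
    from tendsto_mult[OF L this] show ?thesis by (simp only: qratio_add G_def)
  qed
  then show thesis by (rule that)
qed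

lemma qratio_converges:
  fixes c :: complex
  assumes c: "c \<in> primitive_roots_unity (2 * t + 1)" and t: "t > 0"
  shows "\<exists>L. ((\<lambda>z. qratio z k) \<longlongrightarrow> L) (at c)"
proof -
  let ?d = "2 * t + 1"
  have "k mod ?d \<le> 2 * t" using mod_less_divisor[of ?d k] by simp
  moreover have "k = k div ?d * ?d + k mod ?d" by (rule div_mult_mod_eq[symmetric])
  ultimately show ?thesis using qratio_limit[OF c t, of "k div ?d"] by metis
qed

text \<open>The powers of \<open>c\<close> have period \<open>2 * t + 1\<close> in \<open>k\<close>,
  and the odd block length splits the sign into one for \<open>l\<close> and one for
  \<open>i\<close>. Each block therefore tends to a multiple of the first, with a factor independent
  of \<open>i\<close>.\<close>

lemma lhs_term_limit:
  fixes c :: complex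
  assumes c: "c \<in> primitive_roots_unity (2 * t + 1)" and t: "t > 0"
  obtains M where "\<And>i. i \<le> 2 * t \<Longrightarrow> ((\<lambda>z. lhs_term z 2 (l * (2 * t + 1) + i)) \<longlongrightarrow> M * lhs_term c 2 i) (at c)"
proof -
  note facts = primitive_root_unity_facts[OF c t]
  let ?d = "2 * t + 1"
  obtain L where L: "\<And>i. i \<le> 2 * t \<Longrightarrow> ((\<lambda>z. qratio z (l * ?d + i)) \<longlongrightarrow> L * qratio c i) (at c)"
    using qratio_limit[OF c t] by blast
  have "((\<lambda>z. lhs_term z 2 (l * ?d + i)) \<longlongrightarrow> ((- 1) ^ l * L ^ 5) * lhs_term c 2 i) (at c)" if i: "i \<le> 2 * t" for i
  proof -
    define k where "k = l * ?d + i"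
    have "((\<lambda>z. lhs_term z 2 k) \<longlongrightarrow> (- 1) ^ k * ((1 - c powi (4 * int k - 1)) / (1 - c))
        * (L * qratio c i) ^ 5 * c ^ (k\<^sup>2 + 5 * k)) (at c)"
      unfolding lhs_term_2 k_def using facts(2,3) L[OF i] by (intro tendsto_intros) auto
    moreover have "(- 1) ^ k = (- 1) ^ l * (- 1 :: complex) ^ i"
      by (cases "even l"; cases "even i") (simp_all add: k_def)
    moreover have "c powi (4 * int k - 1) = c powi (4 * int i - 1)"
    proof -
      have "4 * int k - 1 = int ?d * (4 * int l) + (4 * int i - 1)"
        by (simp add: k_def algebra_simps)
      moreover have "c powi (int ?d * (4 * int l)) = 1"
        unfolding power_int_mult power_int_of_nat facts(1) by simp
      ultimately show ?thesis by (simp only: power_int_add[OF disjI1[OF facts(2)]] mult_1_left)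
    qed
    moreover have "c ^ (k\<^sup>2 + 5 * k) = c ^ (i\<^sup>2 + 5 * i)"
    proof -
      have "k\<^sup>2 + 5 * k = ?d * (l * (l * ?d + 2 * i + 5)) + (i\<^sup>2 + 5 * i)"
        by (simp add: k_def power2_eq_square algebra_simps)
      moreover have "c ^ (?d * j) = 1" for j by (simp only: power_mult facts(1) power_one)
      ultimately show ?thesis by (simp only: power_add[of c "?d * _"] mult_1_left)
    qed
    ultimately show ?thesis
      unfolding k_def[symmetric] by (simp add: lhs_term_2[of c] power_mult_distrib mult_ac)
  qed
  then show thesis by (rule that)
qed

text \<open>The full blocks and the partial one all contain the indices up to \<open>t + 1\<close>,
  whose terms cancel, while later terms are 0. This is where \<open>t + 2 \<le> r\<close>
  enters.\<close>

lemma lhs_sum_limit: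
  fixes c :: complex
  assumes c: "c \<in> primitive_roots_unity (2 * t + 1)" and t: "t > 0" and r: "t + 2 \<le> r" "r \<le> 2 * t + 1"
  shows "((\<lambda>z. \<Sum>k<l * (2 * t + 1) + r. lhs_term z 2 k) \<longlongrightarrow> 0) (at c)"
proof -
  note facts = primitive_root_unity_facts[OF c t]
  let ?d = "2 * t + 1"
  have zero: "(\<Sum>i<r. lhs_term c 2 i) = 0" if "t + 2 \<le> r" "r \<le> ?d" for r
  proof -
    have "(\<Sum>i<r. lhs_term c 2 i) = (\<Sum>i\<le>t + 1. lhs_term c 2 i)"
      using that lhs_term_tail[OF facts(1)] by (intro sum.mono_neutral_right) auto
    also have "\<dots> = 0"
      using facts(4)[of "t + 1"] t by (intro sum_lhs_term_at_root_unity facts(1)) (auto simp: qpoch2_2)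
    finally show ?thesis .
  qed
  have "\<exists>M. \<forall>i\<le>2 * t. ((\<lambda>z. lhs_term z 2 (j * ?d + i)) \<longlongrightarrow> M * lhs_term c 2 i) (at c)" for j
    using lhs_term_limit[OF c t, of j] by metis
  then obtain M where M: "\<And>j i. i \<le> 2 * t \<Longrightarrow> ((\<lambda>z. lhs_term z 2 (j * ?d + i)) \<longlongrightarrow> M j * lhs_term c 2 i) (at c)"
    by metis
  have "((\<lambda>z. (\<Sum>j<l. \<Sum>i<?d. lhs_term z 2 (j * ?d + i)) + (\<Sum>i<r. lhs_term z 2 (l * ?d + i)))
    \<longlongrightarrow> (\<Sum>j<l. \<Sum>i<?d. M j * lhs_term c 2 i) + (\<Sum>i<r. M l * lhs_term c 2 i)) (at c)"
    using r by (intro tendsto_intros M) auto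
  also have "(\<Sum>j<l. \<Sum>i<?d. M j * lhs_term c 2 i) + (\<Sum>i<r. M l * lhs_term c 2 i) = 0"
    using t r by (simp only: zero sum_distrib_left[symmetric]) (simp add: zero)
  finally show ?thesis by (simp only: sum_blocks)
qed

text \<open>Dropping the first two factors of \<open>qpoch (inverse z) (z\<^sup>2) (k + 2)\<close>
  leaves \<open>qpoch (z ^ 3) (z\<^sup>2) k\<close>. Each summand is thus
  \<open>qratio z k ^ 3\<close> times a function continuous at \<open>c\<close>.\<close>

lemma rhs_sum_converges:
  fixes c :: complex
  assumes c: "c \<in> primitive_roots_unity (2 * t + 1)" and t: "t > 0"
  shows "\<exists>L. ((\<lambda>z. rhs_sum z 2 N) \<longlongrightarrow> L) (at c)"
proof -
  note facts = primitive_root_unity_facts[OF c t]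
  from qratio_converges[OF c t] obtain U where U: "\<And>k. ((\<lambda>z. qratio z k) \<longlongrightarrow> U k) (at c)" by metis
  let ?v = "\<lambda>k z. qratio z k ^ 3 * ((1 - inverse z * (z\<^sup>2) ^ k) * (1 - inverse z * (z\<^sup>2) ^ Suc k)
    / ((1 - inverse z) * (1 - z))) * z ^ (3 * k)"
  define V where "V k = U k ^ 3 * ((1 - inverse c * (c\<^sup>2) ^ k) * (1 - inverse c * (c\<^sup>2) ^ Suc k)
    / ((1 - inverse c) * (1 - c))) * c ^ (3 * k)" for k
  have V: "((\<lambda>z. ?v k z) \<longlongrightarrow> V k) (at c)" for k
    unfolding V_def by (intro tendsto_intros U) (use facts(2,3) in auto)
  have "((\<lambda>z. \<Sum>k\<le>N. ?v k z) \<longlongrightarrow> (\<Sum>k\<le>N. V k)) (at c)"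
    by (intro tendsto_sum V)
  moreover have "\<forall>\<^sub>F z in at c. (\<Sum>k\<le>N. ?v k z) = rhs_sum z 2 N"
    using eventually_at_no_root_unity[of 1 c]
  proof eventually_elim
    case (elim z)
    then have z: "z \<noteq> 0" "z \<noteq> 1" by (auto dest!: spec[of _ 1])
    have s: "inverse z * z\<^sup>2 = z" "z * z\<^sup>2 = z ^ 3" using z by (simp_all add: power2_eq_square power3_eq_cube)
    have "qpoch (inverse z) (z\<^sup>2) k * ((1 - inverse z * (z\<^sup>2) ^ k) * (1 - inverse z * (z\<^sup>2) ^ Suc k))
        = qpoch (inverse z) (z\<^sup>2) (Suc (Suc k))" for k by (simp only: qpoch_Suc mult.assoc)
    also have "\<dots> k = (1 - inverse z) * (1 - z) * qpoch (z ^ 3) (z\<^sup>2) k" for k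
      by (simp only: qpoch_Suc_left s mult.assoc)
    finally have q3: "qpoch (z ^ 3) (z\<^sup>2) k = qpoch (inverse z) (z\<^sup>2) k
        * ((1 - inverse z * (z\<^sup>2) ^ k) * (1 - inverse z * (z\<^sup>2) ^ Suc k)) / ((1 - inverse z) * (1 - z))" for k
      using z by simp
    show ?case
      unfolding rhs_sum_def qpoch2_2 q3 qratio_def
      by (intro sum.cong refl) (simp only: power_divide power2_eq_square power3_eq_cube, simp add: mult_ac)
  qed
  ultimately have "((\<lambda>z. rhs_sum z 2 N) \<longlongrightarrow> (\<Sum>k\<le>N. V k)) (at c)"
    by (rule tendsto_cong[THEN iffD1, rotated])
  then show ?thesis by blast
qed

text \<open>The order of \<open>c\<close> is an odd divisor \<open>2 * s + 1\<close> of
  \<open>n\<close>, and the left-hand sum consists of whole blocks of that length and a remainder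
  covered by \<open>lhs_sum_limit\<close>. On the right \<open>1 - z ^ n\<close> tends to 0 and the
  other factors converge.\<close>

lemma simple_root_limit:
  fixes c :: complex
  assumes n: "odd n" and m: "m = n - 1 \<or> m = (n + 1) div 2" and c: "c ^ n = 1" "c \<noteq> 1"
  shows "((\<lambda>z. (\<Sum>k\<le>m. lhs_term z 2 k) - (1 - z ^ n) / (1 - z) * (- z) ^ e * rhs_sum z 2 N) \<longlongrightarrow> 0) (at c)"
proof -
  have "n > 0" using n by (rule odd_pos)
  then obtain d where d: "d dvd n" "c \<in> primitive_roots_unity d"
    using roots_unity_partition[of n] c(1) by blast
  have "odd d" using d(1) n by (metis dvd_trans)
  then obtain s where s: "d = 2 * s + 1" by (elim oddE)
  have "s > 0" using d(2) c(2) s by (cases s) (auto simp: primitive_roots_unity_def)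
  obtain j where j: "n = d * j" using d(1) by (elim dvdE)
  then have "odd j" using n by simp
  then obtain l where "j = 2 * l + 1" by (elim oddE)
  with j s have l: "n = (2 * s + 1) * (2 * l + 1)" by simp
  note prim = d(2)[unfolded s]
  have "((\<lambda>z. \<Sum>k\<le>m. lhs_term z 2 k) \<longlongrightarrow> 0) (at c)"
  proof -
    from m consider "m = n - 1" | "m = (n + 1) div 2" by blast
    then have "\<exists>j r. Suc m = j * (2 * s + 1) + r \<and> s + 2 \<le> r \<and> r \<le> 2 * s + 1"
    proof cases
      case 1
      \<comment> \<open>All blocks are whole; the last one serves as the remainder.\<close>
      then have "Suc m = (2 * l) * (2 * s + 1) + (2 * s + 1)"
        using \<open>n > 0\<close> by (simp add: l algebra_simps)
      then show ?thesis using \<open>s > 0\<close> by (intro exI[of _ "2 * l"] exI[of _ "2 * s + 1"]) simp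
    next
      case 2
      \<comment> \<open>Counting the index 0, the remainder has length \<open>s + 2\<close>, the
        smallest that \<open>lhs_sum_limit\<close> admits.\<close>
      have "n + 1 = 2 * (l * (2 * s + 1) + s + 1)" by (simp add: l algebra_simps)
      then have "Suc m = l * (2 * s + 1) + (s + 2)" unfolding 2 by simp
      then show ?thesis using \<open>s > 0\<close> by (intro exI[of _ l] exI[of _ "s + 2"]) simp
    qed
    then obtain j r where jr: "Suc m = j * (2 * s + 1) + r" "s + 2 \<le> r" "r \<le> 2 * s + 1" by blast
    show ?thesis
      using lhs_sum_limit[OF prim \<open>s > 0\<close> jr(2,3), of j]
      by (simp only: jr(1)[symmetric] lessThan_Suc_atMost)
  qed
  moreover obtain L where "((\<lambda>z. rhs_sum z 2 N) \<longlongrightarrow> L) (at c)"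
    using rhs_sum_converges[OF prim \<open>s > 0\<close>] by blast
  then have "((\<lambda>z. (1 - z ^ n) / (1 - z) * (- z) ^ e * rhs_sum z 2 N)
      \<longlongrightarrow> (1 - c ^ n) / (1 - c) * (- c) ^ e * L) (at c)"
    using c(2) by (intro tendsto_intros) auto
  ultimately have "((\<lambda>z. (\<Sum>k\<le>m. lhs_term z 2 k) - (1 - z ^ n) / (1 - z) * (- z) ^ e * rhs_sum z 2 N)
     \<longlongrightarrow> 0 - (1 - c ^ n) / (1 - c) * (- c) ^ e * L) (at c)"
    by (rule tendsto_diff)
  then show ?thesis by (simp add: c(1))
qed

section \<open>Assembly of the congruence from the limits at roots of unity\<close>

theorem theorem5p1:
  fixes n m :: nat
  assumes "n > 1" and "odd n" and "m = n - 1 \<or> m = (n + 1) div 2"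
  shows "fract_cong
    (\<Sum>k=0..m. (-1) ^ k * qint (4 * int k - 1)
        * (qpoch (inverse q) (q ^ 2) k ^ 5 / qpoch (q ^ 2) (q ^ 2) k ^ 5) * q ^ (k ^ 2 + 5 * k))
    (qint (int n) * (- q) powi ((int n + 1) * (int n - 3) div 4)
        * (\<Sum>k=0..(n + 1) div 2.
            qpoch (inverse q) (q ^ 2) k ^ 2 * qpoch (q ^ 3) (q ^ 2) k / qpoch (q ^ 2) (q ^ 2) k ^ 3
              * q ^ (3 * k)))
    (qint_poly n * cyclotomic n ^ 2)"
proof -
  obtain t where nt: "n = 2 * t + 1" using assms(2) by (elim oddE)
  have t: "t > 0" using assms(1) nt by simp
  have N: "(n + 1) div 2 = t + 1" by (simp add: nt)
  \<comment> \<open>For \<open>n = 2 * t + 1\<close> the exponent is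
    \<open>(2 * t + 2) * (2 * t - 2) / 4\<close>, which is nonnegative because
    \<open>t > 0\<close>.\<close>
  have e: "(int n + 1) * (int n - 3) div 4 = int (t\<^sup>2 - 1)"
  proof -
    have "(int n + 1) * (int n - 3) = 4 * (int t ^ 2 - 1)"
      by (simp add: nt algebra_simps power2_eq_square)
    moreover have "int (t\<^sup>2 - 1) = int t ^ 2 - 1" using t by (simp add: of_nat_diff)
    ultimately show ?thesis by simp
  qed
  \<comment> \<open>\<open>?f\<close> and \<open>?g\<close> copy the two sides literally with
    \<open>z\<close> for \<open>q\<close>, so that the closure rules for \<open>represents\<close>
    apply to them structurally.\<close>
  let ?f = "\<lambda>z :: complex. \<Sum>k=0..m. (-1) ^ k * ((1 - z powi (4 * int k - 1)) / (1 - z))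
      * (qpoch (inverse z) (z ^ 2) k ^ 5 / qpoch (z ^ 2) (z ^ 2) k ^ 5) * z ^ (k ^ 2 + 5 * k)"
  let ?g = "\<lambda>z :: complex. (1 - z powi int n) / (1 - z) * (- z) powi ((int n + 1) * (int n - 3) div 4)
      * (\<Sum>k=0..(n + 1) div 2. qpoch (inverse z) (z ^ 2) k ^ 2 * qpoch (z ^ 3) (z ^ 2) k
          / qpoch (z ^ 2) (z ^ 2) k ^ 3 * z ^ (3 * k))"
  have f: "?f z = (\<Sum>k\<le>m. lhs_term z 2 k)" for z
    by (simp add: lhs_term_2 qratio_def power_divide atLeast0AtMost)
  have g: "?g z = (1 - z ^ n) / (1 - z) * (- z) ^ (t\<^sup>2 - 1) * rhs_sum z 2 (t + 1)" for z
    unfolding e N rhs_sum_def qpoch2_2 power_int_of_nat atLeast0AtMost ..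
  show ?thesis
  proof (rule fract_congI[OF assms(1), where f = ?f and g = ?g])
    show "((\<lambda>z. ?f z - ?g z) \<longlongrightarrow> 0) (at c)" if "c ^ n = 1" "c \<noteq> 1" for c
      unfolding f g using assms that by (intro simple_root_limit)
    show "((\<lambda>z. (?f z - ?g z) / (z - c)\<^sup>2) \<longlongrightarrow> 0) (at c)" if "c \<in> primitive_roots_unity n" for c
    proof -
      have "t + 1 \<le> m" "m \<le> 2 * t" using assms(3) t by (auto simp: nt)
      then show ?thesis
        unfolding f g using that t unfolding nt by (intro primitive_root_limit)
    qed
  qed (intro represents_sum represents_mult represents_divide represents_power represents_power_int
      represents_minus represents_qint represents_qpoch represents_inverse represents_q represents_1)+
qed

end
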